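(* There exists a $\min\left\{1+\frac{5\,k_h}{|\mathrm{OPT}|},\,3\right\}$-competitive algorithm for the MST problem under explorable uncertainty with predictions on instances that are prediction mandatory free and have a unique lower limit tree $T_L$ and unique upper limit tree $T_U$ with $T_L=T_U$.
   Context: MST problem under explorable uncertainty with predictions: a connected (multi)graph $G=(V,E)$; each edge $e$ has unknown true weight $w_e\in\mathbb{R}_+$ and known uncertainty interval $I_e$, either open $(L_e,U_e)\ni w_e$ or trivial $\{w_e\}$ (then $L_e=U_e=w_e$). Querying $e$ reveals $w_e$. $Q\subseteq E$ is a feasible query set if some spanning tree is a minimum spanning tree for every weight assignment equal to $w_e$ on $Q$ and arbitrary in $I_e$ outside $Q$; $\mathrm{OPT}$ is a minimum-cardinality feasible query set. The algorithm queries adaptively until its query set $\mathrm{ALG}$ is feasible, receiving predictions $\hat w_e\in I_e$; $\rho$-competitive means $|\mathrm{ALG}|\le\rho|\mathrm{OPT}|$ on every instance of the class. Hop distance: for distinct $e,e'$, $k_{e'}(e)=0$ if $w_e$ and $\hat w_e$ lie in the same one of the regions $(-\infty,L_{e'}]$, $(L_{e'},U_{e'})$, $[U_{e'},\infty)$, else $1$; $k_h=\sum_e\sum_{e'\ne e}k_{e'}(e)$. A lower limit tree $T_L$ is an MST for weights $L_e+\epsilon$, an upper limit tree $T_U$ an MST for weights $U_e-\epsilon$, with $\epsilon>0$ infinitesimally small. An edge is prediction mandatory if it belongs to every feasible query set under the hypothesis that all true values equal the predictions; an instance is prediction mandatory free if it has none. *)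

theory Defs
  imports Complex_Main
begin

text \<open>
  The data known in advance to a query algorithm: a multigraph (\<open>ends e\<close> is the set of the one or
  two endpoints of \<open>e\<close>, so parallel edges and loops are possible), the limits of the uncertainty
  intervals and the predicted weights.  The true weights \<open>w :: 'e \<Rightarrow> real\<close> are kept apart.
\<close>

record ('v, 'e) problem =
  verts :: "'v set"
  edges :: "'e set"
  ends :: "'e \<Rightarrow> 'v set"
  low :: "'e \<Rightarrow> real"
  upp :: "'e \<Rightarrow> real"
  pred :: "'e \<Rightarrow> real"

definition connected_by :: "('v, 'e) problem \<Rightarrow> 'e set \<Rightarrow> bool" where
  "connected_by P F \<longleftrightarrow>
     (\<forall>u \<in> verts P. \<forall>v \<in> verts P. (u, v) \<in> {(x, y). \<exists>e \<in> F. ends P e = {x, y}}\<^sup>*)"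

text \<open>A loop is a cycle of length 1 and two parallel edges form a cycle of length 2.\<close>

definition is_cycle :: "('v, 'e) problem \<Rightarrow> 'v list \<Rightarrow> 'e list \<Rightarrow> bool" where
  "is_cycle P vs es \<longleftrightarrow>
     es \<noteq> [] \<and> length vs = length es \<and> distinct vs \<and> distinct es \<and>
     (\<forall>i < length es. ends P (es ! i) = {vs ! i, vs ! (Suc i mod length es)})"

definition spanning_tree :: "('v, 'e) problem \<Rightarrow> 'e set \<Rightarrow> bool" where
  "spanning_tree P T \<longleftrightarrow>
     T \<subseteq> edges P \<and> connected_by P T \<and> \<not> (\<exists>vs es. set es \<subseteq> T \<and> is_cycle P vs es)"

definition is_mst :: "('v, 'e) problem \<Rightarrow> ('e \<Rightarrow> real) \<Rightarrow> 'e set \<Rightarrow> bool" where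
  "is_mst P c T \<longleftrightarrow>
     spanning_tree P T \<and> (\<forall>T'. spanning_tree P T' \<longrightarrow> sum c T \<le> sum c T')"

definition interval :: "('v, 'e) problem \<Rightarrow> 'e \<Rightarrow> real set" where
  "interval P e = (if low P e = upp P e then {low P e} else {low P e <..< upp P e})"

definition valid_instance :: "('v, 'e) problem \<Rightarrow> ('e \<Rightarrow> real) \<Rightarrow> bool" where
  "valid_instance P w \<longleftrightarrow>
     finite (verts P) \<and> verts P \<noteq> {} \<and> finite (edges P) \<and>
     (\<forall>e \<in> edges P. ends P e \<subseteq> verts P \<and> card (ends P e) \<in> {1, 2}) \<and>
     connected_by P (edges P) \<and>
     (\<forall>e \<in> edges P. 0 \<le> w e \<and> w e \<in> interval P e \<and> pred P e \<in> interval P e)"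

definition feasible :: "('v, 'e) problem \<Rightarrow> ('e \<Rightarrow> real) \<Rightarrow> 'e set \<Rightarrow> bool" where
  "feasible P w Q \<longleftrightarrow>
     Q \<subseteq> edges P \<and>
     (\<exists>T. spanning_tree P T \<and>
       (\<forall>c. (\<forall>e \<in> Q. c e = w e) \<and> (\<forall>e \<in> edges P - Q. c e \<in> interval P e) \<longrightarrow> is_mst P c T))"

text \<open>Feasibility depends only on revealed weights, so an algorithm can detect it.\<close>

lemma feasible_cong:
  assumes "\<And>e. e \<in> Q \<Longrightarrow> w e = w' e"
  shows "feasible P w Q \<longleftrightarrow> feasible P w' Q"
  using assms by (simp add: feasible_def)

text \<open>The size of an optimal query set; the full edge set is feasible on every valid instance.\<close>

definition opt :: "('v, 'e) problem \<Rightarrow> ('e \<Rightarrow> real) \<Rightarrow> nat" where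
  "opt P w = (LEAST k. \<exists>Q. feasible P w Q \<and> card Q = k)"

definition hop :: "('v, 'e) problem \<Rightarrow> ('e \<Rightarrow> real) \<Rightarrow> 'e \<Rightarrow> 'e \<Rightarrow> nat" where
  "hop P w e' e =
     (if \<exists>R \<in> {{..low P e'}, {low P e' <..< upp P e'}, {upp P e'..}}. w e \<in> R \<and> pred P e \<in> R
      then 0 else 1)"

definition hop_distance :: "('v, 'e) problem \<Rightarrow> ('e \<Rightarrow> real) \<Rightarrow> nat" where
  "hop_distance P w = (\<Sum>e \<in> edges P. \<Sum>e' \<in> edges P - {e}. hop P w e' e)"

text \<open>``Infinitesimally small'' is read as ``for all sufficiently small positive reals''.\<close>

definition lower_limit_tree :: "('v, 'e) problem \<Rightarrow> 'e set \<Rightarrow> bool" where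
  "lower_limit_tree P T \<longleftrightarrow> (\<forall>\<^sub>F \<epsilon> in at_right 0. is_mst P (\<lambda>e. low P e + \<epsilon>) T)"

definition upper_limit_tree :: "('v, 'e) problem \<Rightarrow> 'e set \<Rightarrow> bool" where
  "upper_limit_tree P T \<longleftrightarrow> (\<forall>\<^sub>F \<epsilon> in at_right 0. is_mst P (\<lambda>e. upp P e - \<epsilon>) T)"

definition unique_equal_limit_trees :: "('v, 'e) problem \<Rightarrow> bool" where
  "unique_equal_limit_trees P \<longleftrightarrow>
     (\<exists>!T. lower_limit_tree P T) \<and> (\<exists>!T. upper_limit_tree P T) \<and>
     (THE T. lower_limit_tree P T) = (THE T. upper_limit_tree P T)"

definition prediction_mandatory :: "('v, 'e) problem \<Rightarrow> 'e \<Rightarrow> bool" where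
  "prediction_mandatory P e \<longleftrightarrow> e \<in> edges P \<and> (\<forall>Q. feasible P (pred P) Q \<longrightarrow> e \<in> Q)"

definition prediction_mandatory_free :: "('v, 'e) problem \<Rightarrow> bool" where
  "prediction_mandatory_free P \<longleftrightarrow> \<not> (\<exists>e. prediction_mandatory P e)"

text \<open>
  A deterministic adaptive algorithm chooses its next query from the known data and the list of
  edges queried so far together with their revealed weights.
\<close>

type_synonym ('v, 'e) algorithm = "('v, 'e) problem \<Rightarrow> ('e \<times> real) list \<Rightarrow> 'e"

primrec transcript ::
  "('v, 'e) algorithm \<Rightarrow> ('v, 'e) problem \<Rightarrow> ('e \<Rightarrow> real) \<Rightarrow> nat \<Rightarrow> ('e \<times> real) list" where
  "transcript alg P w 0 = []"
| "transcript alg P w (Suc n) =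
     (let h = transcript alg P w n
      in if feasible P w (fst ` set h) then h else h @ [(alg P h, w (alg P h))])"

definition queried ::
  "('v, 'e) algorithm \<Rightarrow> ('v, 'e) problem \<Rightarrow> ('e \<Rightarrow> real) \<Rightarrow> nat \<Rightarrow> 'e set" where
  "queried alg P w n = fst ` set (transcript alg P w n)"

text \<open>
  Once the query set is feasible the transcript no longer changes, so all \<open>n\<close> below with a feasible
  query set yield the same set ALG.  An algorithm that never reaches a feasible query set, for
  example because it queries something outside the edge set, is not competitive.
\<close>

definition competitive ::
  "('v, 'e) algorithm \<Rightarrow> (('v, 'e) problem \<Rightarrow> ('e \<Rightarrow> real) \<Rightarrow> real) \<Rightarrow>
    (('v, 'e) problem \<times> ('e \<Rightarrow> real)) set \<Rightarrow> bool" where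
  "competitive alg \<rho> C \<longleftrightarrow>
     (\<forall>(P, w) \<in> C. \<exists>n. feasible P w (queried alg P w n) \<and>
        real (card (queried alg P w n)) \<le> \<rho> P w * real (opt P w))"

end

theory Submission
  imports Defs
begin

text \<open>
  Let \<open>T\<close> be the common limit tree.  An instance without prediction mandatory edges has predictions that
  confirm \<open>T\<close>: if \<open>f\<close> can replace \<open>e\<close> in \<open>T\<close>, then \<open>pred e \<le> low f\<close> and \<open>upp e \<le> pred f\<close>.  So, were all
  predictions correct, the feasible query sets would be the vertex covers of the bipartite graph of
  pairs \<open>(e, f)\<close> of this kind with overlapping intervals, and in general a matching in this graph has at
  most \<open>OPT + k\<^sub>h\<close> edges.

  The algorithm queries the vertices of a minimum vertex cover in an order in which each of them forms a
  witness pair with its partner in a maximum matching.  When an answer contradicts a prediction, the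
  minimum spanning tree for the current lower limits acquires conflicts that the graph does not contain.
  The first of them, in the order of lower limits, yields a mandatory edge or a witness pair that can be
  charged to a new hop error.  Once all of them are repaired, every edge of the graph has survived unless a
  new hop error concerns one of its ends, so the number of augmentations needed to rebuild a maximum
  matching is bounded by the number of new hop errors.

  Robustness: the repair queries number at most \<open>2 OPT\<close>, as they come in disjoint witness pairs, and
  the planned ones at most \<open>OPT\<close>, as their partners are distinct.  A partner that a rebuilt matching
  would use a second time is queried as well.  This completes a group of three queries that meets every
  feasible set, and since it happens at most twice per augmentation, the total is at most
  \<open>OPT + 4 k\<^sub>h\<close>.
\<close>


section \<open>Bipartite matchings\<close>

definition matching :: "('a \<times> 'b) set \<Rightarrow> bool" where
  "matching M \<longleftrightarrow> inj_on fst M \<and> inj_on snd M"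

definition covers :: "'a set \<Rightarrow> ('a \<times> 'a) set \<Rightarrow> bool" where
  "covers V G \<longleftrightarrow> (\<forall>(e, f) \<in> G. e \<in> V \<or> f \<in> V)"

definition matched :: "('a \<times> 'a) set \<Rightarrow> 'a set" where
  "matched M = fst ` M \<union> snd ` M"

lemma matchingD1: "matching M \<Longrightarrow> (t, f) \<in> M \<Longrightarrow> (t, f') \<in> M \<Longrightarrow> f = f'"
  unfolding matching_def inj_on_def by (metis fst_conv snd_conv)

lemma matchingD2: "matching M \<Longrightarrow> (t, f) \<in> M \<Longrightarrow> (t', f) \<in> M \<Longrightarrow> t = t'"
  unfolding matching_def inj_on_def by (metis fst_conv snd_conv)

lemma matching_subset: "matching M \<Longrightarrow> M' \<subseteq> M \<Longrightarrow> matching M'"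
  unfolding matching_def by (meson inj_on_subset)

lemma card_matched:
  assumes "finite M" "matching M" "fst ` M \<inter> snd ` M = {}"
  shows "card (matched M) = 2 * card M"
proof -
  have "card (matched M) = card (fst ` M) + card (snd ` M)"
    unfolding matched_def using assms by (intro card_Un_disjoint) auto
  then show ?thesis using assms(2) card_image[of fst M] card_image[of snd M] unfolding matching_def by simp
qed

lemma card_matching_le_cover:
  assumes "matching M" "covers V M" "finite V" "fst ` M \<inter> snd ` M = {}"
  shows "card M \<le> card V"
proof -
  define g where "g m = (if fst m \<in> V then fst m else snd m)" for m :: "'a \<times> 'a"
  have "inj_on g M"
  proof (rule inj_onI)
    fix m m' assume a: "m \<in> M" "m' \<in> M" "g m = g m'"
    have "fst m \<noteq> snd m'" "fst m' \<noteq> snd m" using a assms(4) by blast+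
    then have "fst m = fst m' \<or> snd m = snd m'"
      using a(3) unfolding g_def by (auto split: if_splits)
    then show "m = m'" using a assms(1) unfolding matching_def inj_on_def by blast
  qed
  moreover have "g ` M \<subseteq> V" using assms(2) unfolding covers_def g_def by fastforce
  ultimately show ?thesis using assms(3) card_inj_on_le by blast
qed

text \<open>Only left vertices are listed: each is reached from its predecessor by an edge of
  \<open>G\<close> to a right vertex and from there by an edge of \<open>M\<close>.\<close>

fun alternating :: "('a \<times> 'b) set \<Rightarrow> ('a \<times> 'b) set \<Rightarrow> 'a \<Rightarrow> 'a list \<Rightarrow> bool" where
  "alternating G M a [] = True"
| "alternating G M a (t # ts) = ((\<exists>f. (a, f) \<in> G \<and> (t, f) \<in> M) \<and> alternating G M t ts)"

lemma alternating_append: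
  "alternating G M a (xs @ ys) \<longleftrightarrow> alternating G M a xs \<and> alternating G M (last (a # xs)) ys"
  by (induction xs arbitrary: a) auto

lemma alternating_change:
  "alternating G M a ts \<Longrightarrow> (\<And>t f. t \<in> set ts \<Longrightarrow> (t, f) \<in> M \<Longrightarrow> (t, f) \<in> M') \<Longrightarrow>
   alternating G M' a ts"
  by (induction ts arbitrary: a) auto

text \<open>Flipping the path moves the unmatched place on the left from \<open>a\<close> to the end
  of the path, while the right side stays matched. The induction gives the partner of
  \<open>t\<close> to \<open>a\<close> and goes on from \<open>t\<close>, which has become
  free.\<close>

lemma shift_along_alternating:
  assumes "finite M" "M \<subseteq> G" "matching M" "a \<notin> fst ` M" "distinct (a # ts)" "alternating G M a ts"
  shows "\<exists>M'. M' \<subseteq> G \<and> matching M' \<and> finite M' \<and> snd ` M' = snd ` M \<and>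
              fst ` M' = insert a (fst ` M) - {last (a # ts)}"
  using assms
proof (induction ts arbitrary: a M)
  case Nil
  then show ?case by (intro exI[of _ M]) auto
next
  case (Cons t ts)
  obtain f where f: "(a, f) \<in> G" "(t, f) \<in> M" using Cons.prems by auto
  define M1 where "M1 = insert (a, f) (M - {(t, f)})"
  have only: "(t', f') \<in> M \<Longrightarrow> t' = t \<longleftrightarrow> f' = f" for t' f'
    using Cons.prems(3) f(2) by (meson matchingD1 matchingD2)
  have fst1: "fst ` M1 = insert a (fst ` M - {t})"
    unfolding M1_def using only f by force
  have snd1: "snd ` M1 = snd ` M"
    unfolding M1_def using only f by force
  have "inj_on fst (M - {(t, f)})" "inj_on snd (M - {(t, f)})"
    using Cons.prems(3) unfolding matching_def by (auto intro: inj_on_subset)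
  moreover have "a \<notin> fst ` (M - {(t, f)})" using Cons.prems(4) by blast
  moreover have "f \<notin> snd ` (M - {(t, f)})" using only by force
  ultimately have m1: "matching M1"
    unfolding matching_def M1_def by (auto simp: inj_on_insert)
  have t1: "t \<notin> fst ` M1" using fst1 Cons.prems(5) by auto
  have a1: "alternating G M1 t ts"
  proof (rule alternating_change)
    show "alternating G M t ts" using Cons.prems(6) by simp
    show "(t', f') \<in> M1" if "t' \<in> set ts" "(t', f') \<in> M" for t' f'
      using that Cons.prems(5) unfolding M1_def by auto
  qed
  have "finite M1" "M1 \<subseteq> G" "distinct (t # ts)"
    using Cons.prems(1,2,5) f(1) unfolding M1_def by auto
  from Cons.IH[OF this(1,2) m1 t1 this(3) a1] obtain M' where M': "M' \<subseteq> G" "matching M'" "finite M'"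
    "snd ` M' = snd ` M1" "fst ` M' = insert t (fst ` M1) - {last (t # ts)}"
    by (elim exE conjE)
  have "t \<in> fst ` M" using f(2) by force
  then have "insert t (fst ` M1) = insert a (fst ` M)" using fst1 by blast
  then show ?case using M' snd1 by (intro exI[of _ M']) simp
qed

text \<open>Koenig's argument: \<open>ZT\<close> holds the left vertices reachable from free ones,
  \<open>ZF\<close> their neighbours. A free vertex in \<open>ZF\<close> ends an augmenting path;
  otherwise \<open>ZF\<close> and the unreached left vertices form the cover. Augmenting keeps
  matched vertices matched, which later bounds the number of newly matched ones.\<close>

lemma matching_augment_or_cover:
  assumes "finite G" "fst ` G \<inter> snd ` G = {}" "M \<subseteq> G" "matching M"
  shows "(\<exists>M'. M' \<subseteq> G \<and> matching M' \<and> matched M \<subseteq> matched M' \<and> card M < card M') \<or>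
         (\<exists>V. covers V G \<and> V \<subseteq> matched M \<and> (\<forall>(e, f) \<in> M. e \<in> V \<longleftrightarrow> f \<notin> V))"
proof -
  define ZT where "ZT = {t. \<exists>a ts. a \<notin> fst ` M \<and> distinct (a # ts) \<and> alternating G M a ts \<and> t = last (a # ts)}"
  define ZF where "ZF = {f. \<exists>t \<in> ZT. (t, f) \<in> G}"
  have fin: "finite M" using assms finite_subset by blast
  have free: "t \<in> ZT" if "t \<notin> fst ` M" for t
    unfolding ZT_def using that by (intro CollectI exI[of _ t] exI[of _ "[]"]) auto
  have step: "t' \<in> ZT" if t: "t \<in> ZT" and tf: "(t, f) \<in> G" "(t', f) \<in> M" for t t' f
  proof -
    obtain a ts where a: "a \<notin> fst ` M" "distinct (a # ts)" "alternating G M a ts" "t = last (a # ts)"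
      using t ZT_def by blast
    have "t' \<noteq> a" using a(1) tf(2) by force
    show ?thesis
    \<comment> \<open>If \<open>t'\<close> already occurs on the path, its initial segment up to
      \<open>t'\<close> serves, so the vertices stay distinct.\<close>
    proof (cases "t' \<in> set ts")
      case True
      then obtain xs ys where "ts = xs @ t' # ys" by (meson split_list)
      then have "ts = (xs @ [t']) @ ys" by simp
      then have "alternating G M a (xs @ [t'])" "distinct (a # (xs @ [t']))" "t' = last (a # (xs @ [t']))"
        using a(2,3) alternating_append[of G M a "xs @ [t']" ys] by auto
      with a(1) show ?thesis unfolding ZT_def by blast
    next
      case False
      have "alternating G M a (ts @ [t'])" using a tf by (auto simp: alternating_append)
      moreover have "distinct (a # (ts @ [t']))" "t' = last (a # (ts @ [t']))"
        using False a(2) \<open>t' \<noteq> a\<close> by auto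
      ultimately show ?thesis unfolding ZT_def using a(1) by blast
    qed
  qed
  show ?thesis
  proof (cases "ZF \<subseteq> snd ` M")
    case False
    then obtain t f where tf: "t \<in> ZT" "(t, f) \<in> G" "f \<notin> snd ` M" unfolding ZF_def by blast
    then obtain a ts where a: "a \<notin> fst ` M" "distinct (a # ts)" "alternating G M a ts" "t = last (a # ts)"
      using ZT_def by blast
    obtain M' where M': "M' \<subseteq> G" "matching M'" "finite M'" "snd ` M' = snd ` M"
      "fst ` M' = insert a (fst ` M) - {t}"
      using shift_along_alternating[OF fin assms(3,4) a(1-3)] a(4) by metis
    define M2 where "M2 = insert (t, f) M'"
    have nin: "t \<notin> fst ` M'" "f \<notin> snd ` M'" using M' tf by auto
    have "matching M2" using M'(2) nin unfolding M2_def matching_def by (auto simp: inj_on_insert)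
    moreover have "M2 \<subseteq> G" using M' tf unfolding M2_def by simp
    moreover have "matched M \<subseteq> matched M2" unfolding matched_def M2_def using M' by auto
    moreover have "card M' = card M"
      by (metis M'(2,4) assms(4) card_image matching_def)
    then have "card M < card M2" unfolding M2_def using nin M'(3) by (subst card_insert_disjoint) force+
    ultimately show ?thesis by blast
  next
    case True
    define V where "V = ZF \<union> (fst ` M - ZT)"
    have ZFG: "ZF \<subseteq> snd ` G" unfolding ZF_def by force
    have "covers V G" unfolding covers_def V_def ZF_def using free by blast
    moreover have "V \<subseteq> matched M" using True unfolding V_def matched_def by auto
    moreover have "e \<in> V \<longleftrightarrow> f \<notin> V" if "(e, f) \<in> M" for e f
    proof -
      have "(e, f) \<in> G" using that assms(3) by blast
      then have "e \<notin> ZF" "f \<notin> fst ` M" using ZFG assms(2,3) by force+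
      moreover have "f \<in> ZF \<longleftrightarrow> e \<in> ZT" using \<open>(e, f) \<in> G\<close> that step unfolding ZF_def by blast
      moreover have "e \<in> fst ` M" using that by force
      ultimately show ?thesis unfolding V_def by blast
    qed
    ultimately show ?thesis by blast
  qed
qed

text \<open>Repeated augmentation ends because a matching has at most \<open>card G\<close> edges.
  Starting from \<open>M0\<close> lets the surviving part of an older matching be reused.\<close>

lemma matching_extends_to_cover:
  assumes "finite G" "fst ` G \<inter> snd ` G = {}" "M0 \<subseteq> G" "matching M0"
  shows "\<exists>M V. M \<subseteq> G \<and> matching M \<and> matched M0 \<subseteq> matched M \<and>
               covers V G \<and> V \<subseteq> matched M \<and> (\<forall>(e, f) \<in> M. e \<in> V \<longleftrightarrow> f \<notin> V)"
  using assms(3,4)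
proof (induction "card G - card M0" arbitrary: M0 rule: less_induct)
  case less
  have cardle: "card M' \<le> card G" if "M' \<subseteq> G" for M' using that assms(1) by (rule card_mono[rotated])
  from matching_augment_or_cover[OF assms(1,2) less.prems] show ?case
  proof
    assume "\<exists>M'. M' \<subseteq> G \<and> matching M' \<and> matched M0 \<subseteq> matched M' \<and> card M0 < card M'"
    then obtain M' where M': "M' \<subseteq> G" "matching M'" "matched M0 \<subseteq> matched M'" "card M0 < card M'" by blast
    then have "card G - card M' < card G - card M0" using cardle[of M'] by linarith
    from less.hyps[OF this M'(1,2)] M'(3) show ?thesis by (meson order_trans)
  qed (use less.prems in blast)
qed

lemma card_exact_cover:
  assumes "finite M" "matching M" "V \<subseteq> matched M" "\<forall>(e, f) \<in> M. e \<in> V \<longleftrightarrow> f \<notin> V"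
    "fst ` M \<inter> snd ` M = {}"
  shows "card V = card M"
proof -
  define g where "g m = (if fst m \<in> V then fst m else snd m)" for m :: "'a \<times> 'a"
  have "inj_on g M"
  proof (rule inj_onI)
    fix m m' assume a: "m \<in> M" "m' \<in> M" "g m = g m'"
    have "fst m \<noteq> snd m'" "fst m' \<noteq> snd m" using a assms(5) by blast+
    then have "fst m = fst m' \<or> snd m = snd m'"
      using a(3) unfolding g_def by (auto split: if_splits)
    then show "m = m'" using a assms(2) unfolding matching_def inj_on_def by blast
  qed
  moreover have "g ` M = V"
  proof
    show "g ` M \<subseteq> V" using assms(4) unfolding g_def by fastforce
    show "V \<subseteq> g ` M"
    proof
      fix v assume "v \<in> V"
      then obtain m where "m \<in> M" "v = fst m \<or> v = snd m" using assms(3) unfolding matched_def by blast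
      then have "v = g m" using \<open>v \<in> V\<close> assms(4) unfolding g_def by (cases m) auto
      then show "v \<in> g ` M" using \<open>m \<in> M\<close> by blast
    qed
  qed
  ultimately show ?thesis using card_image by metis
qed

section \<open>Bases of a closure operator with the exchange property\<close>

text \<open>A finite matroid given by its closure operator: \<open>J F x\<close> says that
  \<open>x\<close> lies in the closure of \<open>F\<close>. For graphs it will mean that
  \<open>F\<close> connects the ends of \<open>x\<close>, and bases become spanning trees.\<close>

locale exchange_closure =
  fixes E :: "'e set" and J :: "'e set \<Rightarrow> 'e \<Rightarrow> bool"
  assumes finE: "finite E"
    and J_in: "F \<subseteq> E \<Longrightarrow> x \<in> F \<Longrightarrow> J F x"
    and J_trans: "F \<subseteq> E \<Longrightarrow> G \<subseteq> E \<Longrightarrow> x \<in> E \<Longrightarrow> J F x \<Longrightarrow> (\<And>y. y \<in> F \<Longrightarrow> J G y) \<Longrightarrow> J G x"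
    and J_exchange: "F \<subseteq> E \<Longrightarrow> x \<in> E \<Longrightarrow> y \<in> E \<Longrightarrow> J (insert y F) x \<Longrightarrow> \<not> J F x \<Longrightarrow> J (insert x F) y"
begin

definition base :: "'e set \<Rightarrow> bool" where
  "base S \<longleftrightarrow> S \<subseteq> E \<and> (\<forall>x \<in> E. J S x) \<and> (\<forall>x \<in> S. \<not> J (S - {x}) x)"

text \<open>For trees: \<open>e\<close> lies on the cycle closed by \<open>f\<close>, equivalently
  \<open>f\<close> crosses the cut left by \<open>e\<close>. In matroid terms this describes the
  fundamental circuit of \<open>f\<close> and the fundamental cocircuit of \<open>e\<close>.\<close>

definition exch :: "'e set \<Rightarrow> 'e \<Rightarrow> 'e \<Rightarrow> bool" where
  "exch S e f \<longleftrightarrow> e \<in> S \<and> f \<in> E - S \<and> base (insert f (S - {e}))"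

lemma J_mono: "J F x \<Longrightarrow> F \<subseteq> G \<Longrightarrow> G \<subseteq> E \<Longrightarrow> x \<in> E \<Longrightarrow> J G x"
  by (rule J_trans[of F G]) (auto intro: J_in)

lemma base_subset: "base S \<Longrightarrow> S \<subseteq> E" by (simp add: base_def)

lemma base_finite: "base S \<Longrightarrow> finite S" using base_subset finE finite_subset by blast

lemma base_swap_iff:
  assumes "base S" "e \<in> S" "f \<in> E - S"
  shows "base (insert f (S - {e})) \<longleftrightarrow> \<not> J (S - {e}) f"
proof
  assume "base (insert f (S - {e}))"
  then have "\<not> J (insert f (S - {e}) - {f}) f" unfolding base_def by blast
  then show "\<not> J (S - {e}) f" using assms(3) by (metis DiffE Diff_insert_absorb insertCI insertE insert_Diff)
next
  assume nJ: "\<not> J (S - {e}) f"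
  let ?S = "insert f (S - {e})"
  have sub: "S \<subseteq> E" "?S \<subseteq> E" "e \<in> E" "f \<in> E" using assms base_subset by auto
  have "J (insert e (S - {e})) f" using assms unfolding base_def by (simp add: insert_absorb)
  then have Je: "J ?S e" using nJ J_exchange[of "S - {e}" f e] sub by blast
  have "J ?S x" if "x \<in> E" for x
  proof (rule J_trans[of S ?S x])
    show "J S x" using that assms unfolding base_def by blast
    fix y assume "y \<in> S" then show "J ?S y" using Je J_in[OF sub(2)] by (cases "y = e") auto
  qed (use sub that in auto)
  moreover have "\<not> J (?S - {x}) x" if x: "x \<in> ?S" for x
  proof (cases "x = f")
    case True
    then show ?thesis using nJ assms(3) by (metis DiffE Diff_insert_absorb insert_Diff insert_iff)
  next
    case False
    then have xS: "x \<in> S" "x \<noteq> e" using x by auto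
    let ?F = "S - {e} - {x}"
    have "\<not> J ?F x"
      using xS assms(1) J_mono[of ?F x "S - {x}"] sub unfolding base_def by blast
    moreover have "insert x ?F = S - {e}" "?S - {x} = insert f ?F" using xS False by auto
    ultimately show ?thesis using J_exchange[of ?F x f] nJ sub xS(1) by auto
  qed
  ultimately show "base ?S" unfolding base_def using sub by blast
qed

lemma cocircuit_iff:
  assumes "base S" "e \<in> S" "x \<in> E"
  shows "x = e \<or> exch S e x \<longleftrightarrow> \<not> J (S - {e}) x"
proof (cases "x \<in> S")
  case True
  have "\<not> J (S - {e}) e" using assms unfolding base_def by blast
  moreover have "J (S - {e}) x" if "x \<noteq> e" using True that assms base_subset by (intro J_in) auto
  ultimately show ?thesis using True unfolding exch_def by auto
next
  case False
  then show ?thesis using base_swap_iff[of S e x] assms unfolding exch_def by auto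
qed

lemma circuit:
  assumes "base S" "f \<in> E - S" "z = f \<or> exch S z f"
  shows "J (insert f {x. exch S x f} - {z}) z"
proof -
  have sub: "S \<subseteq> E" using assms base_subset by auto
  \<comment> \<open>A minimal subset \<open>p\<close> of \<open>S\<close> that spans
    \<open>f\<close> is taken. Minimality and exchange put each of its elements into the closure of
    \<open>f\<close> and the others; \<open>p\<close> turns out to be the fundamental circuit
    without \<open>f\<close>.\<close>
  have fin: "finite {p. p \<subseteq> S \<and> J p f}" using base_finite[OF assms(1)] by simp
  moreover have "S \<in> {p. p \<subseteq> S \<and> J p f}" using assms unfolding base_def by blast
  ultimately have "\<exists>p \<in> {p. p \<subseteq> S \<and> J p f}. \<forall>q \<in> {p. p \<subseteq> S \<and> J p f}. q \<subseteq> p \<longrightarrow> p = q"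
    by (intro finite_has_minimal) auto
  then obtain p where p: "p \<subseteq> S" "J p f" "\<And>q. q \<subseteq> S \<Longrightarrow> J q f \<Longrightarrow> q \<subseteq> p \<Longrightarrow> p = q"
    by auto
  have pz: "J (insert f (p - {x})) x" if "x \<in> p" for x
  proof -
    have "\<not> J (p - {x}) f" using p(3)[of "p - {x}"] p(1) that by blast
    moreover have "insert x (p - {x}) = p" using that by blast
    ultimately show ?thesis using J_exchange[of "p - {x}" f x] p(1,2) sub that assms(2) by auto
  qed
  have "{x. exch S x f} = p"
  proof (intro set_eqI iffI)
    fix x assume "x \<in> p"
    then have x: "x \<in> S" using p by blast
    have "\<not> J (S - {x}) f"
    proof
      assume Jf: "J (S - {x}) f"
      have "J (S - {x}) x"
      proof (rule J_trans[OF _ _ _ pz[OF \<open>x \<in> p\<close>]])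
        show "S - {x} \<subseteq> E" using sub by blast
        fix y assume "y \<in> insert f (p - {x})"
        then consider "y = f" | "y \<in> S - {x}" using p(1) by blast
        then show "J (S - {x}) y" using Jf sub J_in[of "S - {x}" y] by cases auto
      qed (use p sub x assms in auto)
      then show False using assms(1) x unfolding base_def by blast
    qed
    then show "x \<in> {x. exch S x f}" using base_swap_iff assms x unfolding exch_def by auto
  next
    fix x assume "x \<in> {x. exch S x f}"
    then have x: "x \<in> S" "base (insert f (S - {x}))" unfolding exch_def by auto
    then have "\<not> J (S - {x}) f" using base_swap_iff assms by blast
    then show "x \<in> p" using J_mono[OF p(2), of "S - {x}"] p(1) sub assms(2) by blast
  qed
  moreover have "f \<notin> p" using assms p by blast
  ultimately show ?thesis using assms(3) p(2) pz by (cases "z = f") (auto simp: insert_Diff_if)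
qed

text \<open>The fundamental circuit \<open>{z. z = f \<or> exch S1 z f}\<close> and the fundamental cocircuit
  \<open>{z. z = e \<or> exch S2 e z}\<close> never meet in exactly one element, even for different bases.\<close>

lemma circuit_cocircuit:
  assumes "base S1" "f \<in> E - S1" "base S2" "e \<in> S2"
    and "z = f \<or> exch S1 z f" "z = e \<or> exch S2 e z"
  shows "\<exists>z'. z' \<noteq> z \<and> (z' = f \<or> exch S1 z' f) \<and> (z' = e \<or> exch S2 e z')"
proof (rule ccontr)
  assume "\<not> ?thesis"
  then have no: "\<And>z'. z' \<noteq> z \<Longrightarrow> z' = f \<or> exch S1 z' f \<Longrightarrow> \<not> (z' = e \<or> exch S2 e z')" by blast
  let ?C = "insert f {x. exch S1 x f} - {z}"
  have sub: "S1 \<subseteq> E" "S2 \<subseteq> E" using assms base_subset by auto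
  have CE: "?C \<subseteq> E" using assms(2) sub unfolding exch_def by auto
  have zE: "z \<in> E" using assms(2,5) sub unfolding exch_def by auto
  \<comment> \<open>The circuit without \<open>z\<close> would lie in the hyperplane spanned by
    \<open>S2 - {e}\<close>, and \<open>z\<close> with it, although the cocircuit is the complement
    of this hyperplane.\<close>
  have "J (S2 - {e}) z"
  proof (rule J_trans[OF CE _ zE circuit[OF assms(1,2,5)]])
    show "S2 - {e} \<subseteq> E" using sub by blast
    fix y assume y: "y \<in> ?C"
    then have "y \<in> E" using CE by blast
    then show "J (S2 - {e}) y" using no[of y] y cocircuit_iff[OF assms(3,4)] by blast
  qed
  then show False using cocircuit_iff[OF assms(3,4) zE] assms(6) by blast
qed

section \<open>Local exchange criterion for bases of minimum weight\<close>

lemma exchD: "exch S e f \<Longrightarrow> e \<in> S \<and> f \<in> E \<and> f \<notin> S" by (auto simp: exch_def)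

lemma base_subset_eq:
  assumes "base S" "base S'" "S' \<subseteq> S"
  shows "S' = S"
proof (rule ccontr)
  assume "S' \<noteq> S"
  then obtain x where "x \<in> S" "x \<notin> S'" using assms by blast
  then show False using J_mono[of S' x "S - {x}"] assms unfolding base_def by blast
qed

lemma sum_exch:
  fixes c :: "'e \<Rightarrow> real"
  assumes "base S" "exch S e f"
  shows "sum c (insert f (S - {e})) = sum c S - c e + c f"
  using assms base_finite[OF assms(1)] unfolding exch_def by (simp add: sum_diff1)

text \<open>For \<open>f\<close> in \<open>S' - S\<close>, the circuit of \<open>f\<close> with
  respect to \<open>S\<close> and its cocircuit with respect to \<open>S'\<close> share a second
  element \<open>e\<close>. Replacing \<open>f\<close> by \<open>e\<close> in \<open>S'\<close> does
  not increase the weight and brings \<open>S'\<close> closer to \<open>S\<close>.\<close>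

lemma local_opt_le:
  fixes c :: "'e \<Rightarrow> real"
  assumes S: "base S" and opt: "\<And>e f. exch S e f \<Longrightarrow> c e \<le> c f" and "base S'"
  shows "sum c S \<le> sum c S'"
  using \<open>base S'\<close>
proof (induction "card (S' - S)" arbitrary: S' rule: less_induct)
  case less
  show ?case
  proof (cases "S' \<subseteq> S")
    case True
    then have "S' = S" using base_subset_eq[OF S less.prems] by blast
    then show ?thesis by simp
  next
    case False
    then obtain f where f: "f \<in> S'" "f \<notin> S" by blast
    then have fE: "f \<in> E - S" using base_subset less.prems by blast
    obtain e where e: "e \<noteq> f" "e = f \<or> exch S e f" "e = f \<or> exch S' f e"
      using circuit_cocircuit[OF S fE less.prems f(1), of f] by auto
    then have ex: "exch S e f" "exch S' f e" by auto
    have "e \<in> S" using exchD[OF ex(1)] by blast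
    then have "card (insert e (S' - {f}) - S) < card (S' - S)"
      using f base_finite[OF less.prems] by (intro psubset_card_mono) auto
    from less.hyps[OF this] have "sum c S \<le> sum c (insert e (S' - {f}))" using ex(2) exch_def by blast
    also have "\<dots> \<le> sum c S'" using sum_exch[OF less.prems ex(2), of c] opt[OF ex(1)] by simp
    finally show ?thesis .
  qed
qed

lemma min_base_iff:
  fixes c :: "'e \<Rightarrow> real"
  shows "base S \<and> (\<forall>S'. base S' \<longrightarrow> sum c S \<le> sum c S') \<longleftrightarrow>
         base S \<and> (\<forall>e f. exch S e f \<longrightarrow> c e \<le> c f)"
proof (intro iffI conjI allI impI)
  fix e f assume a: "base S \<and> (\<forall>S'. base S' \<longrightarrow> sum c S \<le> sum c S')" and ex: "exch S e f"
  then have "sum c S \<le> sum c (insert f (S - {e}))" unfolding exch_def by blast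
  then show "c e \<le> c f" using sum_exch[of S e f c] a ex by auto
qed (use local_opt_le in blast)+

text \<open>Among the bases of minimum weight, one with the fewest elements of \<open>N\<close> is
  taken. Elements of \<open>N\<close> thus act as if infinitesimally heavier, with \<open>c\<close>
  itself unperturbed.\<close>

lemma lex_min_base:
  fixes c :: "'e \<Rightarrow> real" and N :: "'e set"
  assumes "\<exists>S. base S"
  shows "\<exists>S. base S \<and> (\<forall>e f. exch S e f \<longrightarrow> c e < c f \<or> c e = c f \<and> (e \<in> N \<longrightarrow> f \<in> N))"
proof -
  have finB: "finite {S. base S}"
    by (rule finite_subset[of _ "Pow E"]) (use base_subset finE in auto)
  define m where "m = Min (sum c ` {S. base S})"
  have m: "m \<le> sum c S" if "base S" for S unfolding m_def using finB that by (intro Min_le) auto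
  define A where "A = {S. base S \<and> sum c S = m}"
  have "m \<in> sum c ` {S. base S}" unfolding m_def using finB assms by (intro Min_in) auto
  then have A: "A \<noteq> {}" unfolding A_def by blast
  then obtain S where S: "S \<in> A" "\<And>S'. S' \<in> A \<Longrightarrow> card (S \<inter> N) \<le> card (S' \<inter> N)"
    using ex_has_least_nat[of "\<lambda>S. S \<in> A" _ "\<lambda>S. card (S \<inter> N)"] by blast
  have bS: "base S" using S A_def by blast
  have "c e < c f \<or> c e = c f \<and> (e \<in> N \<longrightarrow> f \<in> N)" if ex: "exch S e f" for e f
  proof -
    let ?S = "insert f (S - {e})"
    have b: "base ?S" using ex exch_def by blast
    have s: "sum c ?S = sum c S - c e + c f" using sum_exch bS ex by blast
    then have "c e \<le> c f" using m[OF b] S(1) unfolding A_def by simp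
    moreover have "f \<in> N" if eq: "c e = c f" and eN: "e \<in> N"
    proof (rule ccontr)
      assume "f \<notin> N"
      then have "?S \<inter> N = S \<inter> N - {e}" by auto
      then have "?S \<inter> N \<subset> S \<inter> N" using eN exchD[OF ex] by auto
      then have "card (?S \<inter> N) < card (S \<inter> N)" using base_finite[OF bS] by (intro psubset_card_mono) auto
      moreover have "?S \<in> A" using b s eq S(1) unfolding A_def by simp
      ultimately show False using S(2)[of ?S] by simp
    qed
    ultimately show ?thesis by (cases "c e = c f") auto
  qed
  then show ?thesis using bS by blast
qed

end


section \<open>Spanning trees\<close>

definition conn :: "('v, 'e) problem \<Rightarrow> 'e set \<Rightarrow> ('v \<times> 'v) set" where
  "conn P F = {(x, y). \<exists>e \<in> F. ends P e = {x, y}}\<^sup>*"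

definition joined :: "('v, 'e) problem \<Rightarrow> 'e set \<Rightarrow> 'e \<Rightarrow> bool" where
  "joined P F x \<longleftrightarrow> (\<exists>a b. ends P x = {a, b} \<and> (a, b) \<in> conn P F)"

lemma conn_refl [simp]: "(u, u) \<in> conn P F" by (simp add: conn_def)

lemma conn_trans: "(u, v) \<in> conn P F \<Longrightarrow> (v, w) \<in> conn P F \<Longrightarrow> (u, w) \<in> conn P F"
  unfolding conn_def by (rule rtrancl_trans)

lemma conn_sym: "(u, v) \<in> conn P F \<Longrightarrow> (v, u) \<in> conn P F"
  unfolding conn_def by (rule symD[OF sym_rtrancl]) (auto simp: sym_def insert_commute)

lemma conn_edge: "e \<in> F \<Longrightarrow> ends P e = {a, b} \<Longrightarrow> (a, b) \<in> conn P F"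
  unfolding conn_def by blast

lemma joined_iff: "ends P x = {a, b} \<Longrightarrow> joined P F x \<longleftrightarrow> (a, b) \<in> conn P F"
  unfolding joined_def by (metis conn_sym doubleton_eq_iff)

lemma conn_closure:
  assumes "(u, v) \<in> conn P F" "\<And>y. y \<in> F \<Longrightarrow> card (ends P y) \<in> {1, 2} \<Longrightarrow> joined P G y"
  shows "(u, v) \<in> conn P G"
  using assms(1) unfolding conn_def
proof (induction rule: rtrancl_induct)
  case (step y z)
  then obtain e where e: "e \<in> F" "ends P e = {y, z}" by blast
  then have "card (ends P e) \<in> {1, 2}" by (cases "y = z") auto
  then have "(y, z) \<in> conn P G" using assms(2) e joined_iff by metis
  then show ?case using step.IH unfolding conn_def by (meson rtrancl_trans)
qed simp

lemma conn_insert: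
  assumes "(u, v) \<in> conn P (insert e F)" "ends P e = {a, b}"
  shows "(u, v) \<in> conn P F \<or> (u, a) \<in> conn P F \<and> (b, v) \<in> conn P F \<or>
         (u, b) \<in> conn P F \<and> (a, v) \<in> conn P F"
  using assms(1) unfolding conn_def
proof (induction rule: rtrancl_induct)
  case (step y z)
  note IH = step.IH[folded conn_def]
  from step(2) obtain x where x: "x = e \<or> x \<in> F" "ends P x = {y, z}" by blast
  from x(1) have "(u, z) \<in> conn P F \<or> (u, a) \<in> conn P F \<and> (b, z) \<in> conn P F \<or>
         (u, b) \<in> conn P F \<and> (a, z) \<in> conn P F"
  proof
    assume "x = e"
    then have "y = a \<and> z = b \<or> y = b \<and> z = a" using x assms(2) by (auto simp: doubleton_eq_iff)
    then show ?thesis using IH by (metis conn_refl conn_trans)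
  next
    assume "x \<in> F"
    then have "(y, z) \<in> conn P F" using x conn_edge by metis
    then show ?thesis using IH by (meson conn_trans)
  qed
  then show ?case by (simp add: conn_def)
qed simp

text \<open>A connection between the ends of \<open>x\<close> that exists only thanks to
  \<open>y\<close> passes through \<open>y\<close>; its two remaining pieces together with
  \<open>x\<close> connect the ends of \<open>y\<close>.\<close>

lemma joined_exchange:
  assumes "joined P (insert y F) x" "\<not> joined P F x" "ends P y = {c, d}"
  shows "joined P (insert x F) y"
proof -
  obtain a b where ab: "ends P x = {a, b}" "(a, b) \<in> conn P (insert y F)"
    using assms(1) joined_def by metis
  then have nab: "(a, b) \<notin> conn P F" using assms(2) joined_iff by metis
  have mono: "(u, v) \<in> conn P F \<Longrightarrow> (u, v) \<in> conn P (insert x F)" for u v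
    unfolding conn_def by (rule rtrancl_mono[THEN subsetD]) auto
  have e: "(a, b) \<in> conn P (insert x F)" using ab conn_edge by (metis insertI1)
  have "(a, c) \<in> conn P F \<and> (d, b) \<in> conn P F \<or> (a, d) \<in> conn P F \<and> (c, b) \<in> conn P F"
    using conn_insert[OF ab(2) assms(3)] nab by blast
  then have "(c, d) \<in> conn P (insert x F)"
    using mono e by (meson conn_sym conn_trans)
  then show ?thesis using joined_iff[OF assms(3)] by blast
qed

text \<open>\<open>is_cycle\<close> asks for distinct vertices. A path extended by an edge either
  reaches a new vertex or is cut back to the earlier visit.\<close>

lemma simple_path:
  assumes "(a, b) \<in> conn P F"
  shows "\<exists>vs es. vs \<noteq> [] \<and> hd vs = a \<and> last vs = b \<and> distinct vs \<and> length vs = Suc (length es) \<and>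
           (\<forall>i < length es. es ! i \<in> F \<and> ends P (es ! i) = {vs ! i, vs ! Suc i})"
  using assms unfolding conn_def
proof (induction rule: rtrancl_induct)
  case base
  show ?case by (rule exI[of _ "[a]"], rule exI[of _ "[]"]) simp
next
  case (step y z)
  obtain vs es where p: "vs \<noteq> []" "hd vs = a" "last vs = y" "distinct vs" "length vs = Suc (length es)"
    "\<forall>i < length es. es ! i \<in> F \<and> ends P (es ! i) = {vs ! i, vs ! Suc i}"
    using step.IH by blast
  obtain e where e: "e \<in> F" "ends P e = {y, z}" using step(2) by blast
  show ?case
  proof (cases "z \<in> set vs")
    case True
    then obtain k where k: "k < length vs" "vs ! k = z" by (auto simp: in_set_conv_nth)
    have "hd (take (Suc k) vs) = a" using p by simp
    moreover have "last (take (Suc k) vs) = z" using k by (simp add: take_Suc_conv_app_nth)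
    moreover have "take (Suc k) vs \<noteq> []" "distinct (take (Suc k) vs)" using p by auto
    moreover have "length (take (Suc k) vs) = Suc (length (take k es))" using p(5) k by simp
    ultimately show ?thesis using p(6)
      by (intro exI[of _ "take (Suc k) vs"] exI[of _ "take k es"]) auto
  next
    case False
    have "\<forall>i < length (es @ [e]). (es @ [e]) ! i \<in> F \<and>
      ends P ((es @ [e]) ! i) = {(vs @ [z]) ! i, (vs @ [z]) ! Suc i}"
    proof (intro allI impI)
      fix i assume "i < length (es @ [e])"
      then consider "i < length es" | "i = length es" by fastforce
      then show "(es @ [e]) ! i \<in> F \<and> ends P ((es @ [e]) ! i) = {(vs @ [z]) ! i, (vs @ [z]) ! Suc i}"
      proof cases
        case 1
        then show ?thesis using p(5,6) by (simp add: nth_append)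
      next
        case 2
        then have "vs ! i = y" using p(1,3,5) by (simp add: last_conv_nth)
        then show ?thesis using 2 p(5) e by (simp add: nth_append)
      qed
    qed
    then show ?thesis using p False
      by (intro exI[of _ "vs @ [z]"] exI[of _ "es @ [e]"]) auto
  qed
qed

text \<open>A cycle without its last edge joins the ends of that edge; conversely a simple path
  between the ends of \<open>e\<close> closes with \<open>e\<close> to a cycle. A loop corresponds
  to the path without edges.\<close>

lemma acyclic_iff:
  assumes "\<And>e. e \<in> T \<Longrightarrow> card (ends P e) \<in> {1, 2}"
  shows "(\<exists>vs es. set es \<subseteq> T \<and> is_cycle P vs es) \<longleftrightarrow> (\<exists>e \<in> T. joined P (T - {e}) e)"
proof
  assume "\<exists>vs es. set es \<subseteq> T \<and> is_cycle P vs es"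
  then obtain vs es where c: "set es \<subseteq> T" "es \<noteq> []" "length vs = length es" "distinct es"
    "\<And>i. i < length es \<Longrightarrow> ends P (es ! i) = {vs ! i, vs ! (Suc i mod length es)}"
    unfolding is_cycle_def by blast
  define n where "n = length es - 1"
  have n: "n < length es" "Suc n = length es" using c(2) unfolding n_def by (auto simp: Suc_le_eq)
  define e where "e = es ! n"
  have path: "(vs ! 0, vs ! k) \<in> conn P (T - {e})" if "k \<le> n" for k
    using that
  proof (induction k)
    case (Suc k)
    then have "es ! k \<in> T" "es ! k \<noteq> e"
      using c(1,4) n unfolding e_def by (auto simp: nth_eq_iff_index_eq)
    moreover have "ends P (es ! k) = {vs ! k, vs ! Suc k}" using c(5)[of k] Suc.prems n by simp
    ultimately have "(vs ! k, vs ! Suc k) \<in> conn P (T - {e})" using conn_edge by (metis DiffI singletonD)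
    then show ?case using Suc by (meson Suc_leD conn_trans)
  qed simp
  have "ends P e = {vs ! n, vs ! 0}" using c(5)[OF n(1)] n(2) unfolding e_def by simp
  then have "joined P (T - {e}) e" using joined_iff conn_sym[OF path[OF order_refl]] by metis
  moreover have "e \<in> T" using c(1) n unfolding e_def by auto
  ultimately show "\<exists>e \<in> T. joined P (T - {e}) e" by blast
next
  assume "\<exists>e \<in> T. joined P (T - {e}) e"
  then obtain e a b where e: "e \<in> T" "ends P e = {a, b}" "(a, b) \<in> conn P (T - {e})"
    unfolding joined_def by blast
  from simple_path[OF e(3)] obtain vs es where p: "vs \<noteq> []" "hd vs = a" "last vs = b" "distinct vs"
    "length vs = Suc (length es)"
    "\<forall>i < length es. es ! i \<in> T - {e} \<and> ends P (es ! i) = {vs ! i, vs ! Suc i}"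
    by blast
  have "distinct es"
  proof (subst distinct_conv_nth, intro allI impI)
    fix i j assume ij: "i < length es" "j < length es" "i \<noteq> j"
    show "es ! i \<noteq> es ! j"
    proof
      assume "es ! i = es ! j"
      then have "{vs ! i, vs ! Suc i} = {vs ! j, vs ! Suc j}" using p(6) ij by metis
      then show False using ij p(4,5) by (auto simp: doubleton_eq_iff nth_eq_iff_index_eq)
    qed
  qed
  moreover have notin: "set es \<subseteq> T - {e}" using p(6) by (auto simp: in_set_conv_nth)
  moreover have "\<forall>i < length (es @ [e]).
    ends P ((es @ [e]) ! i) = {vs ! i, vs ! (Suc i mod length (es @ [e]))}"
  proof (intro allI impI)
    fix i assume "i < length (es @ [e])"
    then consider "i < length es" | "i = length es" by fastforce
    then show "ends P ((es @ [e]) ! i) = {vs ! i, vs ! (Suc i mod length (es @ [e]))}"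
    proof cases
      case 1
      then show ?thesis using p(6) by (simp add: nth_append)
    next
      case 2
      then have "vs ! i = b" using p(1,3,5) by (simp add: last_conv_nth)
      moreover have "vs ! 0 = a" using p(1,2) by (simp add: hd_conv_nth)
      ultimately show ?thesis using 2 e(2) by (auto simp: nth_append)
    qed
  qed
  ultimately have "is_cycle P vs (es @ [e])" using p(4,5) unfolding is_cycle_def by auto
  moreover have "set (es @ [e]) \<subseteq> T" using notin e(1) by auto
  ultimately show "\<exists>vs es. set es \<subseteq> T \<and> is_cycle P vs es" by blast
qed

locale graph =
  fixes P :: "('v, 'e) problem"
  assumes finite_edges: "finite (edges P)"
    and ends_edges: "e \<in> edges P \<Longrightarrow> ends P e \<subseteq> verts P \<and> card (ends P e) \<in> {1, 2}"
    and connected: "connected_by P (edges P)"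
begin

lemma ends_pair: "e \<in> edges P \<Longrightarrow> \<exists>a b. ends P e = {a, b}"
proof -
  assume "e \<in> edges P"
  then have "card (ends P e) = 1 \<or> card (ends P e) = 2" using ends_edges by blast
  then show ?thesis
  proof
    assume "card (ends P e) = 1"
    then obtain a where "ends P e = {a}" using card_1_singletonE by blast
    then show ?thesis by (intro exI[of _ a]) simp
  qed (auto simp: card_2_iff)
qed

sublocale exchange_closure "edges P" "joined P"
proof
  show "finite (edges P)" by (rule finite_edges)
  show "joined P F x" if F: "F \<subseteq> edges P" and x: "x \<in> F" for F x
  proof -
    obtain a b where ab: "ends P x = {a, b}" using F x ends_pair by blast
    show ?thesis using joined_iff[OF ab] conn_edge[OF x ab] by blast
  qed
  show "joined P G x" if F: "joined P F x" and G: "\<And>y. y \<in> F \<Longrightarrow> joined P G y" for F G x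
  proof -
    obtain a b where ab: "ends P x = {a, b}" "(a, b) \<in> conn P F" using F unfolding joined_def by blast
    have "(a, b) \<in> conn P G" by (rule conn_closure[OF ab(2)]) (rule G)
    then show ?thesis using ab(1) unfolding joined_def by blast
  qed
  show "joined P (insert x F) y"
    if y: "y \<in> edges P" and x: "joined P (insert y F) x" "\<not> joined P F x" for F x y
  proof -
    obtain c d where cd: "ends P y = {c, d}" using ends_pair[OF y] by blast
    show ?thesis by (rule joined_exchange[OF x cd])
  qed
qed

lemma connected_by_iff: "F \<subseteq> edges P \<Longrightarrow> connected_by P F \<longleftrightarrow> (\<forall>x \<in> edges P. joined P F x)"
proof
  assume c: "connected_by P F"
  show "\<forall>x \<in> edges P. joined P F x"
  proof
    fix x assume x: "x \<in> edges P"
    then obtain a b where ab: "ends P x = {a, b}" using ends_pair by blast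
    then have "a \<in> verts P" "b \<in> verts P" using ends_edges[OF x] by auto
    then have "(a, b) \<in> conn P F" using c unfolding connected_by_def conn_def by blast
    then show "joined P F x" using joined_iff[OF ab] by blast
  qed
next
  assume j: "\<forall>x \<in> edges P. joined P F x"
  show "connected_by P F"
    unfolding connected_by_def
  proof (intro ballI)
    fix u v assume "u \<in> verts P" "v \<in> verts P"
    then have "(u, v) \<in> conn P (edges P)" using connected unfolding connected_by_def conn_def by blast
    then have "(u, v) \<in> conn P F" by (rule conn_closure) (use j in blast)
    then show "(u, v) \<in> {(x, y). \<exists>e\<in>F. ends P e = {x, y}}\<^sup>*" unfolding conn_def .
  qed
qed

lemma spanning_tree_iff: "spanning_tree P T \<longleftrightarrow> base T"
proof (cases "T \<subseteq> edges P")
  case True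
  then have "(\<exists>vs es. set es \<subseteq> T \<and> is_cycle P vs es) \<longleftrightarrow> (\<exists>e \<in> T. joined P (T - {e}) e)"
    using ends_edges by (intro acyclic_iff) blast
  then show ?thesis using True connected_by_iff[OF True] unfolding spanning_tree_def base_def by blast
qed (simp add: spanning_tree_def base_def)

lemma is_mst_iff: "is_mst P c T \<longleftrightarrow> base T \<and> (\<forall>e f. exch T e f \<longrightarrow> c e \<le> c f)"
  unfolding is_mst_def spanning_tree_iff using min_base_iff[of T c] by simp

end

section \<open>Realizations near the interval limits and edges forced into feasible sets\<close>

lemma exists_between_finite:
  fixes L U :: real
  assumes "finite A" "\<And>a. a \<in> A \<Longrightarrow> L < a" "L < U"
  shows "\<exists>t. L < t \<and> t < U \<and> (\<forall>a \<in> A. t < a)"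
  using assms(1,2)
proof (induction rule: finite_induct)
  case empty
  then show ?case using dense[OF assms(3)] by auto
next
  case (insert a A)
  then obtain t where t: "L < t" "t < U" "\<forall>a \<in> A. t < a" by auto
  moreover have "L < a" using insert.prems by simp
  ultimately obtain s where "L < s" "s < min t a" using dense[of L "min t a"] by auto
  then show ?case using t by (intro exI[of _ s]) auto
qed

lemma exists_between_finite':
  fixes L U :: real
  assumes "finite A" "\<And>a. a \<in> A \<Longrightarrow> a < U" "L < U"
  shows "\<exists>t. L < t \<and> t < U \<and> (\<forall>a \<in> A. a < t)"
proof -
  have "\<exists>t. - U < t \<and> t < - L \<and> (\<forall>a \<in> uminus ` A. t < a)"
    by (rule exists_between_finite) (use assms in auto)
  then obtain t where t: "- U < t" "t < - L" "\<forall>a \<in> uminus ` A. t < a" by blast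
  then show ?thesis by (intro exI[of _ "- t"]) auto
qed

context graph
begin

definition admissible :: "('e \<Rightarrow> real) \<Rightarrow> bool" where
  "admissible w \<longleftrightarrow> (\<forall>e \<in> edges P. w e \<in> interval P e)"

lemma admissible_bounds: "admissible w \<Longrightarrow> e \<in> edges P \<Longrightarrow> low P e \<le> w e \<and> w e \<le> upp P e \<and>
  (low P e < upp P e \<longrightarrow> low P e < w e \<and> w e < upp P e)"
  unfolding admissible_def interval_def by (auto split: if_splits dest!: bspec)

text \<open>The condition on \<open>c\<close> is stated edge by edge so that functions that change
  \<open>w\<close> at one or two edges can be checked directly. For admissible \<open>w\<close> and
  a set of edges \<open>Og\<close> it selects the same \<open>c\<close> as \<open>feasible\<close>
  does.\<close>

definition certified_tree :: "('e \<Rightarrow> real) \<Rightarrow> 'e set \<Rightarrow> 'e set \<Rightarrow> bool" where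
  "certified_tree w Og T \<longleftrightarrow> base T \<and>
     (\<forall>c. (\<forall>x \<in> edges P. c x = w x \<or> x \<notin> Og \<and> c x \<in> interval P x) \<longrightarrow>
          (\<forall>e f. exch T e f \<longrightarrow> c e \<le> c f))"

lemma feasible_iff_certified:
  assumes "admissible w"
  shows "feasible P w Og \<longleftrightarrow> Og \<subseteq> edges P \<and> (\<exists>T. certified_tree w Og T)"
proof -
  have eq: "(\<forall>e\<in>Og. c e = w e) \<and> (\<forall>e\<in>edges P - Og. c e \<in> interval P e) \<longleftrightarrow>
      (\<forall>x \<in> edges P. c x = w x \<or> x \<notin> Og \<and> c x \<in> interval P x)" if "Og \<subseteq> edges P" for c
    using assms that unfolding admissible_def by auto
  show ?thesis
  proof (cases "Og \<subseteq> edges P")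
    case True
    show ?thesis
      unfolding feasible_def certified_tree_def is_mst_iff spanning_tree_iff eq[OF True] by blast
  qed (simp add: feasible_def)
qed

lemma certified_treeD:
  assumes "certified_tree w Og T" "exch T e f"
    and "\<And>x. x \<in> edges P \<Longrightarrow> c x = w x \<or> x \<notin> Og \<and> c x \<in> interval P x"
  shows "c e \<le> c f"
  using assms unfolding certified_tree_def by blast

lemma exch_finite:
  assumes "base S"
  shows "finite {g. exch S e g}" "finite {g. exch S g f}"
proof -
  show "finite {g. exch S e g}" by (rule finite_subset[OF _ finite_edges]) (auto simp: exch_def)
  show "finite {g. exch S g f}" by (rule finite_subset[OF _ base_finite[OF assms]]) (auto simp: exch_def)
qed

lemma exch_edges: "base S \<Longrightarrow> exch S e f \<Longrightarrow> e \<in> edges P \<and> f \<in> edges P \<and> e \<noteq> f \<and> e \<in> S \<and> f \<notin> S"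
  using base_subset exchD by blast

text \<open>If \<open>e\<close> is not queried, two realizations refute every certified tree. Just
  above its lower limit, \<open>e\<close> is the lightest in its cut and must belong to the tree;
  just below its upper limit, it is the heaviest on the cycle of \<open>f\<close> and must
  not.\<close>

lemma tree_edge_in_feasible:
  assumes Og: "feasible P w Og" and w: "admissible w" and S: "base S" and ef: "exch S e f"
    and nontriv: "low P e < upp P e"
    and cut: "\<And>g. exch S e g \<Longrightarrow> low P e < w g"
    and cyc: "\<And>g. exch S g f \<Longrightarrow> g \<noteq> e \<Longrightarrow> w g < upp P e"
    and small: "w f < upp P e \<or> f \<notin> Og \<and> low P f < upp P e"
  shows "e \<in> Og"
proof (rule ccontr)
  assume eO: "e \<notin> Og"
  obtain T where cert: "certified_tree w Og T"
    using Og feasible_iff_certified[OF w] by blast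
  then have T: "base T" unfolding certified_tree_def by blast
  have ed: "e \<in> edges P" "f \<in> edges P" "e \<noteq> f" "e \<in> S" "f \<in> edges P - S" using exch_edges[OF S ef] by auto
  have inter: "interval P e = {low P e <..< upp P e}" using nontriv unfolding interval_def by auto
  have "e \<in> T"
  proof (rule ccontr)
    assume eT: "e \<notin> T"
    have "\<exists>t. low P e < t \<and> t < upp P e \<and> (\<forall>a \<in> w ` {g. exch S e g}. t < a)"
      by (rule exists_between_finite) (use exch_finite(1)[OF S] cut nontriv in auto)
    then obtain t where t: "low P e < t" "t < upp P e" "\<And>g. exch S e g \<Longrightarrow> t < w g" by auto
    obtain z where z: "z \<noteq> e" "z = e \<or> exch T z e" "z = e \<or> exch S e z"
      using circuit_cocircuit[OF T _ S ed(4), of e e] ed(1) eT by auto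
    have "(w(e := t)) z \<le> (w(e := t)) e"
      proof (rule certified_treeD[OF cert, where c = "w(e := t)"])
    show "exch T z e" using z by auto
    show "(w(e := t)) x = w x \<or> x \<notin> Og \<and> (w(e := t)) x \<in> interval P x" for x
      using t(1,2) eO inter by (cases "x = e"; cases "x = f") auto
  qed
    then show False using t(3)[of z] z by auto
  qed
  \<comment> \<open>The weight of \<open>f\<close> in the second realization: its true value if that
    is small enough, otherwise a suitable value from the interval of the unqueried
    \<open>f\<close>.\<close>
  obtain s where s: "s < upp P e" "s = w f \<or> f \<notin> Og \<and> s \<in> interval P f"
  proof (cases "w f < upp P e")
    case False
    then have f: "f \<notin> Og" "low P f < upp P e" using small by auto
    have "low P f \<noteq> upp P f" using admissible_bounds[OF w ed(2)] False f by auto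
    then have "low P f < upp P f" using admissible_bounds[OF w ed(2)] by auto
    then obtain s where "low P f < s" "s < min (upp P e) (upp P f)"
      using f(2) dense[of "low P f" "min (upp P e) (upp P f)"] by auto
    then show ?thesis using that[of s] f(1) unfolding interval_def by auto
  qed (use that[of "w f"] in simp)
  have "\<exists>t. low P e < t \<and> t < upp P e \<and> (\<forall>a \<in> insert s (w ` ({g. exch S g f} - {e})). a < t)"
    by (rule exists_between_finite') (use exch_finite(2)[OF S] cyc nontriv s(1) in auto)
  then obtain t where t: "low P e < t" "t < upp P e" "s < t" "\<And>g. exch S g f \<Longrightarrow> g \<noteq> e \<Longrightarrow> w g < t"
    by auto
  obtain z where z: "z \<noteq> e" "z = f \<or> exch S z f" "z = e \<or> exch T e z"
    using circuit_cocircuit[OF S ed(5) T \<open>e \<in> T\<close>, of e] ef by auto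
  have "(w(e := t, f := s)) e \<le> (w(e := t, f := s)) z"
    proof (rule certified_treeD[OF cert, where c = "w(e := t, f := s)"])
    show "exch T e z" using z by auto
    show "(w(e := t, f := s)) x = w x \<or> x \<notin> Og \<and> (w(e := t, f := s)) x \<in> interval P x" for x
      using t(1,2) eO inter s(2) by (cases "x = e"; cases "x = f") auto
  qed
  moreover have "(w(e := t, f := s)) z < t" using z t(3,4) by auto
  ultimately show False using ed(3) by simp
qed

text \<open>The dual of \<open>tree_edge_in_feasible\<close>, with cycle and cut interchanged: near
  its upper limit \<open>f\<close> has to stay out of the tree, near its lower limit it has to be
  in.\<close>

lemma nontree_edge_in_feasible:
  assumes Og: "feasible P w Og" and w: "admissible w" and S: "base S" and ef: "exch S e f"
    and nontriv: "low P f < upp P f"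
    and cyc: "\<And>g. exch S g f \<Longrightarrow> w g < upp P f"
    and cut: "\<And>g. exch S e g \<Longrightarrow> g \<noteq> f \<Longrightarrow> low P f < w g"
    and large: "low P f < w e \<or> e \<notin> Og \<and> low P f < upp P e"
  shows "f \<in> Og"
proof (rule ccontr)
  assume fO: "f \<notin> Og"
  obtain T where cert: "certified_tree w Og T"
    using Og feasible_iff_certified[OF w] by blast
  then have T: "base T" unfolding certified_tree_def by blast
  have ed: "e \<in> edges P" "f \<in> edges P" "e \<noteq> f" "e \<in> S" "f \<in> edges P - S" using exch_edges[OF S ef] by auto
  have inter: "interval P f = {low P f <..< upp P f}" using nontriv unfolding interval_def by auto
  have "f \<notin> T"
  proof
    assume fT: "f \<in> T"
    have "\<exists>t. low P f < t \<and> t < upp P f \<and> (\<forall>a \<in> w ` {g. exch S g f}. a < t)"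
      by (rule exists_between_finite') (use exch_finite(2)[OF S] cyc nontriv in auto)
    then obtain t where t: "low P f < t" "t < upp P f" "\<And>g. exch S g f \<Longrightarrow> w g < t" by auto
    obtain z where z: "z \<noteq> f" "z = f \<or> exch S z f" "z = f \<or> exch T f z"
      using circuit_cocircuit[OF S ed(5) T fT, of f] by auto
    have "(w(f := t)) f \<le> (w(f := t)) z"
      proof (rule certified_treeD[OF cert, where c = "w(f := t)"])
    show "exch T f z" using z by auto
    show "(w(f := t)) x = w x \<or> x \<notin> Og \<and> (w(f := t)) x \<in> interval P x" for x
      using t(1,2) fO inter by (cases "x = e"; cases "x = f") auto
  qed
    then show False using t(3)[of z] z by auto
  qed
  obtain s where s: "low P f < s" "s = w e \<or> e \<notin> Og \<and> s \<in> interval P e"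
  proof (cases "low P f < w e")
    case False
    then have e: "e \<notin> Og" "low P f < upp P e" using large by auto
    have "low P e \<noteq> upp P e" using admissible_bounds[OF w ed(1)] False e by auto
    then have "low P e < upp P e" using admissible_bounds[OF w ed(1)] by auto
    then obtain s where "max (low P e) (low P f) < s" "s < upp P e"
      using e(2) dense[of "max (low P e) (low P f)" "upp P e"] by auto
    then show ?thesis using that[of s] e(1) unfolding interval_def by auto
  qed (use that[of "w e"] in simp)
  have "\<exists>t. low P f < t \<and> t < upp P f \<and> (\<forall>a \<in> insert s (w ` ({g. exch S e g} - {f})). t < a)"
    by (rule exists_between_finite) (use exch_finite(1)[OF S] cut nontriv s(1) in auto)
  then obtain t where t: "low P f < t" "t < upp P f" "t < s" "\<And>g. exch S e g \<Longrightarrow> g \<noteq> f \<Longrightarrow> t < w g"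
    by auto
  obtain z where z: "z \<noteq> f" "z = f \<or> exch T z f" "z = e \<or> exch S e z"
    using circuit_cocircuit[OF T _ S ed(4), of f f] ed(2) \<open>f \<notin> T\<close> ef by auto
  have "(w(f := t, e := s)) z \<le> (w(f := t, e := s)) f"
    proof (rule certified_treeD[OF cert, where c = "w(f := t, e := s)"])
    show "exch T z f" using z by auto
    show "(w(f := t, e := s)) x = w x \<or> x \<notin> Og \<and> (w(f := t, e := s)) x \<in> interval P x" for x
      using t(1,2) fO inter s(2) by (cases "x = e"; cases "x = f") auto
  qed
  moreover have "t < (w(f := t, e := s)) z" using z t(3,4) by auto
  ultimately show False using ed(3) by simp
qed

end


section \<open>Limit trees and predictions\<close>

context graph
begin

text \<open>Only comparisons between two weights matter, so the infinitesimal shift disappears and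
  the limit trees are the minimum spanning trees for the lower and the upper limits.\<close>

lemma mst_shift_iff: "is_mst P (\<lambda>e. c e + d) S \<longleftrightarrow> is_mst P c S"
  unfolding is_mst_iff by simp

lemma lower_limit_tree_iff: "lower_limit_tree P S \<longleftrightarrow> is_mst P (low P) S"
  unfolding lower_limit_tree_def mst_shift_iff by (simp add: trivial_limit_at_right_real)

lemma upper_limit_tree_iff: "upper_limit_tree P S \<longleftrightarrow> is_mst P (upp P) S"
  unfolding upper_limit_tree_def using mst_shift_iff[of "upp P" "- _" S]
  by (simp add: trivial_limit_at_right_real)

lemma unique_mst_strict:
  assumes mst: "is_mst P c S" and uniq: "\<And>S'. is_mst P c S' \<Longrightarrow> S' = S" and ef: "exch S e f"
  shows "c e < c f"
proof (rule ccontr)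
  assume "\<not> c e < c f"
  moreover have "c e \<le> c f" using mst ef is_mst_iff by blast
  ultimately have "c e = c f" by simp
  moreover have S: "base S" using mst is_mst_iff by blast
  ultimately have "sum c (insert f (S - {e})) = sum c S" using sum_exch[OF S ef, of c] by simp
  moreover have "spanning_tree P (insert f (S - {e}))" using ef spanning_tree_iff unfolding exch_def by blast
  ultimately have "is_mst P c (insert f (S - {e}))" using mst unfolding is_mst_def by simp
  then show False using uniq exchD[OF ef] by blast
qed

end

text \<open>\<open>T\<close> is the common limit tree, and its uniqueness yields the strict
  inequalities. The true weights are not fixed here because the game quantifies over them.\<close>

locale stable_instance = graph P for P :: "('v, 'e) problem" +
  fixes T :: "'e set"
  assumes base_T: "base T"
    and low_less: "exch T e f \<Longrightarrow> low P e < low P f"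
    and upp_less: "exch T e f \<Longrightarrow> upp P e < upp P f"
    and pred_admissible: "admissible (pred P)"
    and mandatory_free: "prediction_mandatory_free P"
begin

lemma not_mandatory:
  assumes "e \<in> edges P"
  obtains Og where "feasible P (pred P) Og" "e \<notin> Og"
  using mandatory_free assms unfolding prediction_mandatory_free_def prediction_mandatory_def by blast

lemmas pred_bounds = admissible_bounds[OF pred_admissible]

text \<open>For an edge \<open>e\<close> of \<open>T\<close> outside \<open>S\<close>, the cut of
  \<open>e\<close> in \<open>T\<close> contains an edge \<open>g\<close> of its cycle in
  \<open>S\<close>. Since \<open>low P e < pred P g\<close> and
  \<open>pred P g \<le> pred P e\<close>, the edge \<open>e\<close> would be prediction
  mandatory.\<close>

lemma pred_mst_contains:
  assumes S: "base S" and opt: "\<And>e f. exch S e f \<Longrightarrow> pred P e \<le> pred P f"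
  shows "T \<subseteq> S"
proof
  fix e assume eT: "e \<in> T"
  then have eE: "e \<in> edges P" using base_T base_subset by blast
  show "e \<in> S"
  proof (rule ccontr)
    assume eS: "e \<notin> S"
    obtain g where g: "g \<noteq> e" "exch S g e" "exch T e g"
      using circuit_cocircuit[OF S _ base_T eT, of e e] eE eS by auto
    have gE: "g \<in> edges P" using exchD[OF g(3)] by blast
    have lt: "low P e < pred P g" using low_less[OF g(3)] pred_bounds[OF gE] by linarith
    have le: "pred P g \<le> pred P e" using opt[OF g(2)] .
    have nt: "low P e < upp P e" using lt le pred_bounds[OF eE] by linarith
    obtain Og where Og: "feasible P (pred P) Og" "e \<notin> Og" using not_mandatory[OF eE] .
    have "e \<in> Og"
    proof (rule nontree_edge_in_feasible[OF Og(1) pred_admissible S g(2) nt])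
      show "pred P h < upp P e" if "exch S h e" for h
        using opt[OF that] pred_bounds[OF eE] nt by linarith
      show "low P e < pred P h" if "exch S g h" "h \<noteq> e" for h
        using opt[OF that(1)] lt by linarith
      show "low P e < pred P g \<or> g \<notin> Og \<and> low P e < upp P g" using lt by blast
    qed
    then show False using Og by blast
  qed
qed

lemma pred_le: "exch T e f \<Longrightarrow> pred P e \<le> pred P f"
proof -
  assume ef: "exch T e f"
  \<comment> \<open>With the empty set as tie-breaker this is any minimum spanning tree for the
    predictions; containing \<open>T\<close>, it equals \<open>T\<close>.\<close>
  obtain S where S: "base S" "\<And>e f. exch S e f \<Longrightarrow> pred P e < pred P f \<or> pred P e = pred P f"
    using lex_min_base[of "pred P" "{}"] base_T by blast
  then have "\<And>e f. exch S e f \<Longrightarrow> pred P e \<le> pred P f" by fastforce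
  moreover from this have "T = S" using base_subset_eq[OF S(1) base_T] pred_mst_contains[OF S(1)] by blast
  ultimately show ?thesis using ef by blast
qed

text \<open>Otherwise \<open>e\<close> would be prediction mandatory: it can fall below all
  predictions in its cut, and the predictions on the cycle of \<open>f\<close> are at most
  \<open>pred P f\<close>, which lies below \<open>upp P e\<close>.\<close>

lemma upp_le_pred:
  assumes ef: "exch T e f"
  shows "upp P e \<le> pred P f"
proof (rule ccontr)
  assume lt: "\<not> upp P e \<le> pred P f"
  have E: "e \<in> edges P" "f \<in> edges P" using exch_edges[OF base_T ef] by auto
  have cut: "low P e < pred P g" if "exch T e g" for g
    using low_less[OF that] pred_bounds[of g] exchD[OF that] by fastforce
  have nt: "low P e < upp P e" using lt cut[OF ef] by linarith
  obtain Og where Og: "feasible P (pred P) Og" "e \<notin> Og" using not_mandatory[OF E(1)] .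
  have "e \<in> Og"
  proof (rule tree_edge_in_feasible[OF Og(1) pred_admissible base_T ef nt cut])
    show "pred P g < upp P e" if "exch T g f" "g \<noteq> e" for g using pred_le[OF that(1)] lt by linarith
    show "pred P f < upp P e \<or> f \<notin> Og \<and> low P f < upp P e" using lt by simp
  qed
  then show False using Og by blast
qed

text \<open>Dually, if \<open>low P f < pred P e\<close>, then all predictions in the cut of
  \<open>e\<close> exceed \<open>low P f\<close>, and \<open>f\<close> would be prediction
  mandatory.\<close>

lemma pred_le_low:
  assumes ef: "exch T e f"
  shows "pred P e \<le> low P f"
proof (rule ccontr)
  assume lt: "\<not> pred P e \<le> low P f"
  have E: "e \<in> edges P" "f \<in> edges P" using exch_edges[OF base_T ef] by auto
  have "pred P e \<le> upp P e" using pred_bounds[OF E(1)] by blast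
  then have nt: "low P f < upp P f" using upp_less[OF ef] lt by linarith
  obtain Og where Og: "feasible P (pred P) Og" "f \<notin> Og" using not_mandatory[OF E(2)] .
  have "f \<in> Og"
  proof (rule nontree_edge_in_feasible[OF Og(1) pred_admissible base_T ef nt])
    show "pred P g < upp P f" if "exch T g f" for g
      using pred_le[OF that] pred_bounds[OF E(2)] nt by linarith
    show "low P f < pred P g" if "exch T e g" "g \<noteq> f" for g using pred_le[OF that(1)] lt by linarith
    show "low P f < pred P e \<or> e \<notin> Og \<and> low P f < upp P e" using lt by simp
  qed
  then show False using Og by blast
qed

section \<open>Conflicts\<close>

text \<open>The bipartite graph of conflicts before any query, with left vertices in
  \<open>T\<close> and right vertices outside \<open>T\<close>.\<close>

definition crit :: "('e \<times> 'e) set" where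
  "crit = {(e, f). exch T e f \<and> low P f < upp P e}"

definition unknown :: "'e set \<Rightarrow> 'e set" where
  "unknown Q = {x \<in> edges P - Q. low P x < upp P x}"

definition lo :: "'e set \<Rightarrow> ('e \<Rightarrow> real) \<Rightarrow> 'e \<Rightarrow> real" where
  "lo Q w x = (if x \<in> Q then w x else low P x)"

definition up :: "'e set \<Rightarrow> ('e \<Rightarrow> real) \<Rightarrow> 'e \<Rightarrow> real" where
  "up Q w x = (if x \<in> Q then w x else upp P x)"

definition confl :: "'e set \<Rightarrow> 'e set \<Rightarrow> ('e \<Rightarrow> real) \<Rightarrow> ('e \<times> 'e) set" where
  "confl S Q w = {(e, f). exch S e f \<and> lo Q w f < up Q w e}"

text \<open>A hop error is attributed to the edge \<open>z\<close> whose interval limits are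
  crossed, not to the mispredicted edge \<open>x\<close>.\<close>

definition err :: "('e \<Rightarrow> real) \<Rightarrow> 'e set \<Rightarrow> 'e \<Rightarrow> bool" where
  "err w W z \<longleftrightarrow> (\<exists>x \<in> W. x \<noteq> z \<and> hop P w z x \<noteq> 0)"

text \<open>The remaining conflicts are among those foreseen in \<open>crit\<close> and concern
  unknown edges only; \<open>S\<close> itself may differ from \<open>T\<close>.\<close>

definition stable :: "'e set \<Rightarrow> 'e set \<Rightarrow> ('e \<Rightarrow> real) \<Rightarrow> bool" where
  "stable S Q w \<longleftrightarrow> base S \<and> confl S Q w \<subseteq> crit \<inter> unknown Q \<times> unknown Q"

text \<open>Ties are broken as if the lower limits of unknown edges were slightly larger, since such an edge
  lies strictly above its lower limit.\<close>

definition low_tree :: "'e set \<Rightarrow> 'e set \<Rightarrow> ('e \<Rightarrow> real) \<Rightarrow> bool" where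
  "low_tree S Q w \<longleftrightarrow> base S \<and>
     (\<forall>e f. exch S e f \<longrightarrow> lo Q w e < lo Q w f \<or> lo Q w e = lo Q w f \<and> (e \<in> unknown Q \<longrightarrow> f \<in> unknown Q))"

lemma low_tree_exists: "\<exists>S. low_tree S Q w"
  unfolding low_tree_def using lex_min_base[of "lo Q w" "unknown Q"] base_T by blast

lemma low_treeD:
  assumes "low_tree S Q w" "exch S e f"
  shows "lo Q w e \<le> lo Q w f" "e \<in> unknown Q \<Longrightarrow> f \<notin> unknown Q \<Longrightarrow> lo Q w e < lo Q w f"
  using assms unfolding low_tree_def by fastforce+

lemma critD:
  assumes "(e, f) \<in> crit"
  shows "exch T e f" "low P e < low P f" "upp P e < upp P f" "low P f < upp P e"
    "pred P e \<le> low P f" "upp P e \<le> pred P f" "low P e < upp P e" "low P f < upp P f"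
    "e \<in> T" "f \<notin> T" "e \<in> edges P" "f \<in> edges P"
proof -
  show ef: "exch T e f" and l: "low P f < upp P e" using assms unfolding crit_def by auto
  show "low P e < low P f" "upp P e < upp P f" "pred P e \<le> low P f" "upp P e \<le> pred P f"
    using low_less upp_less pred_le_low upp_le_pred ef by auto
  then show "low P e < upp P e" "low P f < upp P f" using l by auto
  show "e \<in> T" "f \<notin> T" "e \<in> edges P" "f \<in> edges P" using exch_edges[OF base_T ef] by auto
qed

lemma unknown_limits: "x \<in> unknown Q \<Longrightarrow> lo Q w x = low P x \<and> up Q w x = upp P x \<and> low P x < upp P x \<and> x \<in> edges P \<and> x \<notin> Q"
  unfolding unknown_def lo_def up_def by auto

lemma known_limits:
  assumes "admissible w" "x \<in> edges P" "x \<notin> unknown Q"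
  shows "lo Q w x = w x \<and> up Q w x = w x"
  using admissible_bounds[OF assms(1,2)] assms(2,3) unfolding unknown_def lo_def up_def by auto

lemma lo_up_bounds:
  assumes "admissible w" "x \<in> edges P"
  shows "low P x \<le> lo Q w x" "lo Q w x \<le> w x" "w x \<le> up Q w x" "up Q w x \<le> upp P x"
  using admissible_bounds[OF assms] unfolding lo_def up_def by auto

lemma unknown_strict: "admissible w \<Longrightarrow> x \<in> unknown Q \<Longrightarrow> low P x < w x \<and> w x < upp P x"
  using admissible_bounds[of w x] unfolding unknown_def by auto

lemma hop_above:
  assumes "hop P w e f = 0" "upp P e \<le> pred P f" "low P e < upp P e"
  shows "upp P e \<le> w f"
  using assms unfolding hop_def by (auto split: if_splits)

lemma hop_below:
  assumes "hop P w f e = 0" "pred P e \<le> low P f" "low P f < upp P f"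
  shows "w e \<le> low P f"
  using assms unfolding hop_def by (auto split: if_splits)

lemma conflE:
  assumes "base S" "(e, f) \<in> confl S Q w"
  shows "exch S e f" "lo Q w f < up Q w e" "e \<in> edges P" "f \<in> edges P" "e \<in> S" "f \<notin> S"
  using assms exch_edges[of S e f] unfolding confl_def by auto

text \<open>Below, \<open>S\<close> was stable for the query set \<open>Q0\<close>, which has since been extended to \<open>Q\<close>.\<close>

lemma clean_tree_edge:
  assumes w: "admissible w" and st: "stable S Q0 w" and Q: "Q0 \<subseteq> Q"
    and e: "e \<in> unknown Q" "\<not> err w (Q - Q0) e" and ef: "exch S e f"
  shows "f \<notin> unknown Q \<and> upp P e \<le> w f \<or> f \<in> unknown Q \<and> low P e < low P f \<and> upp P e < upp P f"
proof -
  have S: "base S" and sub: "confl S Q0 w \<subseteq> crit \<inter> unknown Q0 \<times> unknown Q0"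
    using st unfolding stable_def by auto
  have E: "f \<in> edges P" "e \<noteq> f" using exch_edges[OF S ef] by auto
  have e0: "up Q0 w e = upp P e" "low P e < upp P e"
    using e(1) Q unknown_limits[of e Q w] unfolding up_def by auto
  show ?thesis
  \<comment> \<open>A pair that had no conflict at \<open>Q0\<close> is separated already and stays
    so. A conflict belongs to \<open>crit\<close>; if its \<open>f\<close> has been queried since,
    the absence of an error puts \<open>w f\<close> on the side of its prediction.\<close>
  proof (cases "(e, f) \<in> confl S Q0 w")
    case False
    then have le: "upp P e \<le> lo Q0 w f" using ef e0 unfolding confl_def by auto
    show ?thesis
    proof (cases "f \<in> unknown Q")
      case True
      then have "lo Q0 w f = low P f" using Q unknown_limits[of f Q w] unfolding lo_def by auto
      then show ?thesis using True le e0 unknown_limits[OF True, of w] by linarith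
    next
      case False
      then show ?thesis using le lo_up_bounds(2)[OF w E(1), of Q0] by auto
    qed
  next
    case True
    then have cr: "(e, f) \<in> crit" "f \<in> unknown Q0" using sub by auto
    show ?thesis
    proof (cases "f \<in> unknown Q")
      case False
      then have "f \<in> Q - Q0" using cr(2) unfolding unknown_def by auto
      then have "hop P w e f = 0" using e(2) E(2) unfolding err_def by auto
      then show ?thesis using False hop_above critD(6)[OF cr(1)] e0(2) by auto
    qed (use critD[OF cr(1)] in auto)
  qed
qed

lemma clean_nontree_edge:
  assumes w: "admissible w" and st: "stable S Q0 w" and Q: "Q0 \<subseteq> Q"
    and f: "f \<in> unknown Q" "\<not> err w (Q - Q0) f" and ef: "exch S e f"
  shows "e \<notin> unknown Q \<and> w e \<le> low P f \<or> e \<in> unknown Q \<and> low P e < low P f \<and> upp P e < upp P f"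
proof -
  have S: "base S" and sub: "confl S Q0 w \<subseteq> crit \<inter> unknown Q0 \<times> unknown Q0"
    using st unfolding stable_def by auto
  have E: "e \<in> edges P" "e \<noteq> f" using exch_edges[OF S ef] by auto
  have f0: "lo Q0 w f = low P f" "low P f < upp P f"
    using f(1) Q unknown_limits[of f Q w] unfolding lo_def by auto
  show ?thesis
  proof (cases "(e, f) \<in> confl S Q0 w")
    case False
    then have le: "up Q0 w e \<le> low P f" using ef f0 unfolding confl_def by auto
    show ?thesis
    proof (cases "e \<in> unknown Q")
      case True
      then have "up Q0 w e = upp P e" using Q unknown_limits[of e Q w] unfolding up_def by auto
      then show ?thesis using True le f0 unknown_limits[OF True, of w] by linarith
    next
      case False
      then show ?thesis using le lo_up_bounds(3)[OF w E(1), of Q0] by auto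
    qed
  next
    case True
    then have cr: "(e, f) \<in> crit" "e \<in> unknown Q0" using sub by auto
    show ?thesis
    proof (cases "e \<in> unknown Q")
      case False
      then have "e \<in> Q - Q0" using cr(2) unfolding unknown_def by auto
      then have "hop P w f e = 0" using f(2) E(2) unfolding err_def by auto
      then show ?thesis using False hop_below critD(5)[OF cr(1)] f0(2) by auto
    qed (use critD[OF cr(1)] in auto)
  qed
qed

text \<open>If \<open>z\<close> changed sides, some \<open>g\<close> would be exchangeable with it
  in both trees, in opposite directions. The order of lower limits in \<open>S'\<close> then
  contradicts the separation of \<open>z\<close> and \<open>g\<close>.\<close>

lemma clean_in_tree_iff:
  assumes w: "admissible w" and st: "stable S Q0 w" and Q: "Q0 \<subseteq> Q" and S': "low_tree S' Q w"
    and z: "z \<in> unknown Q" "\<not> err w (Q - Q0) z"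
  shows "z \<in> S \<longleftrightarrow> z \<in> S'"
proof -
  have b: "base S" "base S'" using st S' unfolding stable_def low_tree_def by auto
  have zE: "z \<in> edges P" using z unknown_def by auto
  have zl: "lo Q w z = low P z" "low P z < upp P z" using unknown_limits[OF z(1)] by auto
  show ?thesis
  proof (rule iffI; rule ccontr)
    assume i: "z \<in> S" "z \<notin> S'"
    obtain g where g: "exch S' g z" "exch S z g"
      using circuit_cocircuit[OF b(2) _ b(1) i(1), of z z] zE i(2) by auto
    have gE: "g \<in> edges P" using exchD[OF g(2)] by blast
    have "lo Q w g \<le> low P z" using low_treeD(1)[OF S' g(1)] zl by simp
    then show False
      using clean_tree_edge[OF w st Q z g(2)] zl(2) known_limits[OF w gE, of Q] unknown_limits[of g Q w] by auto
  next
    assume i: "z \<in> S'" "z \<notin> S"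
    obtain g where g: "exch S g z" "exch S' z g"
      using circuit_cocircuit[OF b(1) _ b(2) i(1), of z z] zE i(2) by auto
    have gE: "g \<in> edges P" using exchD[OF g(2)] by blast
    \<comment> \<open>For a known \<open>g\<close> the strict inequality is due to the tie-breaking
      in \<open>low_tree\<close>; it excludes \<open>w g = low P z\<close>.\<close>
    have "low P z \<le> lo Q w g" "g \<notin> unknown Q \<Longrightarrow> low P z < lo Q w g"
      using low_treeD[OF S' g(2)] z(1) zl by auto
    then show False
      using clean_nontree_edge[OF w st Q z g(1)] zl(2) known_limits[OF w gE, of Q] unknown_limits[of g Q w] by auto
  qed
qed

text \<open>The cycle of \<open>f\<close> in \<open>S\<close> and the cut of \<open>e\<close> in
  \<open>S'\<close> share an edge \<open>z\<close> other than \<open>e\<close>. If \<open>z\<close>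
  were not \<open>f\<close>, it would belong to \<open>S\<close> and form a new conflict with
  \<open>e\<close>; by \<open>sub\<close> this would be an old one, whose second component lies
  outside \<open>S\<close>.\<close>

lemma conflict_survives:
  assumes w: "admissible w" and st: "stable S Q0 w" and Q: "Q0 \<subseteq> Q" and S': "low_tree S' Q w"
    and sub: "confl S' Q w \<subseteq> confl S Q0 w"
    and ef: "(e, f) \<in> confl S Q0 w"
    and e: "e \<in> unknown Q" "\<not> err w (Q - Q0) e" and f: "f \<in> unknown Q" "\<not> err w (Q - Q0) f"
  shows "(e, f) \<in> confl S' Q w"
proof -
  have b: "base S" "base S'" using st S' unfolding stable_def low_tree_def by auto
  note ef' = conflE[OF b(1) ef]
  have mem: "e \<in> S'" "f \<notin> S'"
    using clean_in_tree_iff[OF w st Q S' e] clean_in_tree_iff[OF w st Q S' f] ef' by auto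
  have lims: "up Q w e = upp P e" "lo Q w f = low P f" using unknown_limits e f by auto
  have lt: "low P f < upp P e"
    using st ef critD(4) unfolding stable_def by blast
  obtain z where z: "z \<noteq> e" "z = f \<or> exch S z f" "exch S' e z"
    using circuit_cocircuit[OF b(1) _ b(2) mem(1), of f e] ef' by auto
  show ?thesis
  proof (cases "z = f")
    case True
    then show ?thesis using z(3) lims lt unfolding confl_def by auto
  next
    case False
    then have zf: "exch S z f" using z(2) by blast
    have zE: "z \<in> edges P" using exchD[OF z(3)] by blast
    have "lo Q w z \<le> low P f"
      using clean_nontree_edge[OF w st Q f zf] known_limits[OF w zE, of Q] unknown_limits[of z Q w] by auto
    then have "(e, z) \<in> confl S' Q w" using z(3) lims lt unfolding confl_def by auto
    then have "z \<notin> S" using sub conflE(6)[OF b(1)] by blast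
    then show ?thesis using exchD[OF zf] by blast
  qed
qed

text \<open>An error-free unknown edge keeps its role in the new tree, so by \<open>circuit_cocircuit\<close> an unexpected
  conflict without errors would force another one with an earlier second component.\<close>

lemma first_unexpected_conflict:
  assumes "base S" "A \<subseteq> confl S Q w" "A \<noteq> {}"
  obtains e f where "(e, f) \<in> A"
    "\<And>e' f'. (e', f') \<in> A \<Longrightarrow> lo Q w f \<le> lo Q w f' \<and> (lo Q w f = lo Q w f' \<longrightarrow> f \<in> unknown Q \<longrightarrow> f' \<in> unknown Q)"
proof -
  define B where "B = snd ` A"
  have fin: "finite B" unfolding B_def using assms(1,2) conflE(4)[OF assms(1)]
    by (intro finite_subset[OF _ finite_edges]) fastforce
  have "B \<noteq> {}" using assms(3) unfolding B_def by auto
  define m where "m = Min (lo Q w ` B)"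
  have m: "\<And>f. f \<in> B \<Longrightarrow> m \<le> lo Q w f" unfolding m_def using fin by (intro Min_le) auto
  have "m \<in> lo Q w ` B" unfolding m_def using fin \<open>B \<noteq> {}\<close> by (intro Min_in) auto
  then obtain f0 where f0: "f0 \<in> B" "lo Q w f0 = m" by auto
  have "\<exists>f \<in> B. lo Q w f = m \<and> (f \<in> unknown Q \<longrightarrow> (\<forall>f' \<in> B. lo Q w f' = m \<longrightarrow> f' \<in> unknown Q))"
    using f0 by blast
  then obtain f where f: "f \<in> B" "lo Q w f = m" "f \<in> unknown Q \<Longrightarrow> \<forall>f' \<in> B. lo Q w f' = m \<longrightarrow> f' \<in> unknown Q"
    by blast
  then obtain e where "(e, f) \<in> A" unfolding B_def by force
  moreover have "lo Q w f \<le> lo Q w f' \<and> (lo Q w f = lo Q w f' \<longrightarrow> f \<in> unknown Q \<longrightarrow> f' \<in> unknown Q)"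
    if "(e', f') \<in> A" for e' f'
  proof -
    have "f' \<in> B" using that unfolding B_def by force
    then show ?thesis using m f by auto
  qed
  ultimately show thesis using that by blast
qed

text \<open>This supplies what a repair needs: maximality of \<open>e\<close> makes the pair a
  witness pair, and errors pay for it. If \<open>e\<close> is free of errors, the pair is an old
  conflict, so the vertex cover contains one of its ends.\<close>

lemma unexpected_conflict_has_error:
  assumes w: "admissible w" and st: "stable S Q0 w" and Q: "Q0 \<subseteq> Q" and S': "low_tree S' Q w"
    and un: "\<not> confl S' Q w \<subseteq> confl S Q0 w \<inter> unknown Q \<times> unknown Q"
  obtains e f where "(e, f) \<in> confl S' Q w" "e \<in> unknown Q" "\<And>g. exch S' g f \<Longrightarrow> up Q w g \<le> up Q w e"
    "f \<notin> unknown Q \<Longrightarrow> err w (Q - Q0) e"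
    "f \<in> unknown Q \<Longrightarrow> err w (Q - Q0) f"
    "f \<in> unknown Q \<Longrightarrow> err w (Q - Q0) e \<or> (e, f) \<in> confl S Q0 w"
proof -
  have b: "base S" "base S'" using st S' unfolding stable_def low_tree_def by auto
  define A where "A = confl S' Q w - confl S Q0 w \<inter> unknown Q \<times> unknown Q"
  obtain e1 f where ef1: "(e1, f) \<in> A" and first:
    "\<And>e' f'. (e', f') \<in> A \<Longrightarrow> lo Q w f \<le> lo Q w f' \<and> (lo Q w f = lo Q w f' \<longrightarrow> f \<in> unknown Q \<longrightarrow> f' \<in> unknown Q)"
    using first_unexpected_conflict[OF b(2), of A Q w] un unfolding A_def by blast
  have ef1': "(e1, f) \<in> confl S' Q w" using ef1 unfolding A_def by blast
  note c1 = conflE[OF b(2) ef1']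
  have unk: "e \<in> unknown Q" if "(e, g) \<in> confl S' Q w" for e g
  proof (rule ccontr)
    note c = conflE[OF b(2) that]
    assume "e \<notin> unknown Q"
    then have "up Q w e = lo Q w e" using known_limits[OF w c(3)] by simp
    then show False using c(2) low_treeD(1)[OF S' c(1)] by simp
  qed
  \<comment> \<open>\<open>e1\<close> is traded for an edge of largest upper limit on the cycle of
    \<open>f\<close>. The result is still a conflict, though possibly not an unexpected one.\<close>
  have fin: "finite (up Q w ` {g. exch S' g f})" using exch_finite(2)[OF b(2)] by simp
  have "up Q w ` {g. exch S' g f} \<noteq> {}" using c1(1) by blast
  then have "Max (up Q w ` {g. exch S' g f}) \<in> up Q w ` {g. exch S' g f}" using fin by simp
  then obtain e where e: "exch S' e f" "up Q w e = Max (up Q w ` {g. exch S' g f})" by auto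
  have emax: "up Q w g \<le> up Q w e" if "exch S' g f" for g using e(2) fin that by simp
  have ef: "(e, f) \<in> confl S' Q w"
    using e(1) c1(2) emax[OF c1(1)] unfolding confl_def by auto
  note eu = unk[OF ef]
  note c = conflE[OF b(2) ef]
  have ferr: "err w (Q - Q0) f" if fu: "f \<in> unknown Q"
  proof (rule ccontr)
    assume ne: "\<not> err w (Q - Q0) f"
    have fS: "f \<notin> S" using clean_in_tree_iff[OF w st Q S' fu ne] c1(6) by blast
    have lf: "lo Q w f = low P f" using unknown_limits[OF fu] by blast
    \<comment> \<open>If \<open>z\<close> is \<open>e1\<close>, the conflict \<open>(e1, f)\<close>
      was expected; otherwise \<open>(e1, z)\<close> is an unexpected conflict that precedes it.
      Both contradict the choice of \<open>f\<close>.\<close>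
    obtain z where z: "z \<noteq> f" "exch S z f" "z = e1 \<or> exch S' e1 z"
      using circuit_cocircuit[OF b(1) _ b(2) c1(5), of f f] c1 fS by auto
    have zS: "z \<in> S" using exchD[OF z(2)] by blast
    then have zE: "z \<in> edges P" using b base_subset by blast
    have ue: "up Q w e1 = upp P e1" using unknown_limits[OF unk[OF ef1']] by blast
    show False
    proof (cases "z = e1")
      case True
      have "up Q0 w e1 = upp P e1" "lo Q0 w f = low P f"
        using unknown_limits[OF unk[OF ef1']] unknown_limits[OF fu] Q unfolding up_def lo_def by auto
      then have "(e1, f) \<in> confl S Q0 w" using True z(2) c1(2) lf ue unfolding confl_def by auto
      then show False using ef1 fu unk[OF ef1'] unfolding A_def by blast
    next
      case False
      note cl = clean_nontree_edge[OF w st Q fu ne z(2)]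
      have lz: "lo Q w z \<le> low P f" "z \<in> unknown Q \<Longrightarrow> lo Q w z < low P f"
        using cl known_limits[OF w zE, of Q] unknown_limits[of z Q w] by auto
      then have "(e1, z) \<in> confl S' Q w" using False z(3) c1(2) lf unfolding confl_def by auto
      moreover have "(e1, z) \<notin> confl S Q0 w" using conflE(6)[OF b(1)] zS by blast
      ultimately have "(e1, z) \<in> A" unfolding A_def by blast
      then show False using first lz lf fu by fastforce
    qed
  qed
  have eerr: "f \<in> unknown Q \<and> (e, f) \<in> confl S Q0 w" if ne: "\<not> err w (Q - Q0) e"
  proof -
    have eS: "e \<in> S" using clean_in_tree_iff[OF w st Q S' eu ne] c(5) by blast
    have ue: "up Q w e = upp P e" "up Q0 w e = upp P e"
      using unknown_limits[OF eu] Q unfolding up_def by auto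
    \<comment> \<open>If \<open>g\<close> is not \<open>f\<close>, then an unknown \<open>g\<close>
      has a larger upper limit than \<open>e\<close>, and a known one is too heavy to lie on the
      cycle of \<open>f\<close> in a low tree.\<close>
    obtain g where g: "g \<noteq> e" "g = f \<or> exch S' g f" "exch S e g"
      using circuit_cocircuit[OF b(2) _ b(1) eS, of f e] c by auto
    have gE: "g \<in> edges P" using exchD[OF g(3)] by blast
    note cl = clean_tree_edge[OF w st Q eu ne g(3)]
    show ?thesis
    proof (cases "g = f")
      case True
      have fu: "f \<in> unknown Q"
        using cl True c(2) ue known_limits[OF w c(4), of Q] by auto
      moreover have "lo Q w f = low P f" "lo Q0 w f = low P f"
        using unknown_limits[OF fu] Q unfolding lo_def by auto
      ultimately show ?thesis using True g(3) c(2) ue unfolding confl_def by auto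
    next
      case False
      then have gf: "exch S' g f" using g(2) by blast
      show ?thesis
      proof (cases "g \<in> unknown Q")
        case True
        then show ?thesis using cl emax[OF gf] ue unknown_limits[OF True] by auto
      next
        case False
        then show ?thesis
          using cl low_treeD(1)[OF S' gf] c(2) ue known_limits[OF w gE, of Q] by auto
      qed
    qed
  qed
  show thesis by (rule that[OF ef eu emax]) (use ferr eerr in blast)+
qed

text \<open>Of all edges in conflict with \<open>f\<close>, \<open>e\<close> has the largest upper
  limit, so it can become the heaviest on the cycle of \<open>f\<close>, while the order of
  \<open>S\<close> lets it become the lightest in its cut. If \<open>f\<close> is known already,
  \<open>e\<close> alone is mandatory.\<close>

lemma max_conflict_witness:
  assumes w: "admissible w" and S: "low_tree S Q w" and ef: "(e, f) \<in> confl S Q w" and eu: "e \<in> unknown Q"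
    and max: "\<And>g. exch S g f \<Longrightarrow> g \<noteq> e \<Longrightarrow> up Q w g \<le> lo Q w f \<or> up Q w g \<le> up Q w e"
    and Og: "feasible P w Og"
  shows "e \<in> Og \<or> f \<in> unknown Q \<and> f \<in> Og"
proof (rule ccontr)
  assume neg: "\<not> ?thesis"
  have b: "base S" using S unfolding low_tree_def by auto
  note c = conflE[OF b ef]
  have ue: "up Q w e = upp P e" "lo Q w e = low P e" "low P e < upp P e" using unknown_limits[OF eu] by auto
  have "e \<in> Og"
  proof (rule tree_edge_in_feasible[OF Og w b c(1) ue(3)])
    show "low P e < w g" if g: "exch S e g" for g
    proof -
      have gE: "g \<in> edges P" using exchD[OF g] by blast
      show ?thesis
        using low_treeD[OF S g] eu ue unknown_strict[OF w, of g Q] unknown_limits[of g Q w] known_limits[OF w gE, of Q]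
        by (cases "g \<in> unknown Q") auto
    qed
    show "w g < upp P e" if g: "exch S g f" "g \<noteq> e" for g
    proof -
      have gE: "g \<in> edges P" using exch_edges[OF b g(1)] by blast
      show ?thesis
        using low_treeD(1)[OF S g(1)] max[OF g] c(2) ue unknown_strict[OF w, of g Q] unknown_limits[of g Q w]
          known_limits[OF w gE, of Q]
        by (cases "g \<in> unknown Q") auto
    qed
    show "w f < upp P e \<or> f \<notin> Og \<and> low P f < upp P e"
      using neg c(2) ue known_limits[OF w c(4), of Q] unknown_limits[of f Q w] by (cases "f \<in> unknown Q") auto
  qed
  then show False using neg by blast
qed

text \<open>The dual, with \<open>f\<close> of smallest lower limit among the edges in conflict with
  \<open>e\<close>. Stability is used on the cycle of \<open>f\<close>: conflicts lie in
  \<open>crit\<close>, so the other upper limits stay below \<open>upp P f\<close>.\<close>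

lemma min_conflict_witness:
  assumes w: "admissible w" and st: "stable S Q w" and ef: "(e, f) \<in> confl S Q w"
    and min: "\<And>g. (e, g) \<in> confl S Q w \<Longrightarrow> low P f \<le> low P g"
    and Og: "feasible P w Og"
  shows "e \<in> Og \<or> f \<in> Og"
proof (rule ccontr)
  assume neg: "\<not> ?thesis"
  have b: "base S" and sub: "confl S Q w \<subseteq> crit \<inter> unknown Q \<times> unknown Q" using st unfolding stable_def by auto
  note c = conflE[OF b ef]
  have eu: "e \<in> unknown Q" and fu: "f \<in> unknown Q" and cr: "(e, f) \<in> crit" using sub ef by auto
  note ue = unknown_limits[OF eu, of w] and uf = unknown_limits[OF fu, of w]
  have nt: "low P f < upp P f" using uf by blast
  have "f \<in> Og"
  proof (rule nontree_edge_in_feasible[OF Og w b c(1) nt])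
    show "w g < upp P f" if g: "exch S g f" for g
    proof -
      have gE: "g \<in> edges P" using exch_edges[OF b g(1)] by blast
      show ?thesis
      proof (cases "(g, f) \<in> confl S Q w")
        case True
        then have "(g, f) \<in> crit" using sub by blast
        then show ?thesis using critD(3) lo_up_bounds(3,4)[OF w gE, of Q] by fastforce
      next
        case False
        then have "up Q w g \<le> low P f" using g uf unfolding confl_def by auto
        then show ?thesis using nt lo_up_bounds(3)[OF w gE, of Q] by simp
      qed
    qed
    show "low P f < w g" if g: "exch S e g" "g \<noteq> f" for g
    proof -
      have gE: "g \<in> edges P" using exchD[OF g(1)] by blast
      show ?thesis
      proof (cases "(e, g) \<in> confl S Q w")
        case True
        then have "g \<in> unknown Q" using sub by blast
        then show ?thesis using min[OF True] unknown_strict[OF w] by fastforce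
      next
        case False
        then have "upp P e \<le> lo Q w g" using g ue unfolding confl_def by auto
        then show ?thesis using critD(4)[OF cr] lo_up_bounds(2)[OF w gE, of Q] by linarith
      qed
    qed
    show "low P f < w e \<or> e \<notin> Og \<and> low P f < upp P e" using neg critD(4)[OF cr] by blast
  qed
  then show False using neg by blast
qed

lemma confl_initial: "confl T {} w = crit"
  unfolding confl_def crit_def lo_def up_def by auto

lemma stable_initial: "stable T {} w"
  unfolding stable_def confl_initial using base_T critD unfolding unknown_def by auto

lemma no_conflict_feasible:
  assumes w: "admissible w" and S: "base S" and no: "confl S Q w = {}" and Q: "Q \<subseteq> edges P"
  shows "feasible P w Q"
  unfolding feasible_iff_certified[OF w] certified_tree_def
proof (intro conjI exI[of _ S] allI impI Q S)
  fix c e f assume c: "\<forall>x\<in>edges P. c x = w x \<or> x \<notin> Q \<and> c x \<in> interval P x" and ef: "exch S e f"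
  have E: "e \<in> edges P" "f \<in> edges P" using exch_edges[OF S ef] by auto
  have b: "lo Q w x \<le> c x \<and> c x \<le> up Q w x" if x: "x \<in> edges P" for x
    using bspec[OF c x] lo_up_bounds[OF w x, of Q] unfolding lo_def up_def interval_def
    by (auto split: if_splits)
  have "\<not> lo Q w f < up Q w e" using no ef unfolding confl_def by blast
  then show "c e \<le> c f" using b[OF E(1)] b[OF E(2)] by simp
qed

section \<open>Counting hop errors\<close>

definition hops :: "('e \<Rightarrow> real) \<Rightarrow> 'e set \<Rightarrow> nat" where
  "hops w W = (\<Sum>x \<in> W. \<Sum>z \<in> edges P - {x}. hop P w z x)"

lemma hop_distance_eq: "hop_distance P w = hops w (edges P)"
  unfolding hop_distance_def hops_def by simp

text \<open>Each \<open>z\<close> with an error contributes a nonzero summand of its own, indexed by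
  \<open>z\<close> and an edge of \<open>W\<close> that crosses one of its limits.\<close>

lemma card_err_le:
  assumes "W \<subseteq> edges P"
  shows "card {z \<in> edges P. err w W z} \<le> hops w W"
proof -
  define K where "K = {p \<in> Sigma W (\<lambda>x. edges P - {x}). hop P w (snd p) (fst p) \<noteq> 0}"
  have finW: "finite W" using assms finite_edges finite_subset by blast
  then have finS: "finite (Sigma W (\<lambda>x. edges P - {x}))" using finite_edges by simp
  then have fin: "finite K" unfolding K_def by simp
  have "{z \<in> edges P. err w W z} \<subseteq> snd ` K" unfolding err_def K_def by force
  then have "card {z \<in> edges P. err w W z} \<le> card K"
    by (meson card_image_le card_mono fin finite_imageI order_trans)
  also have "card K = (\<Sum>p \<in> K. 1)" by simp
  also have "\<dots> \<le> (\<Sum>p \<in> K. hop P w (snd p) (fst p))"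
    by (rule sum_mono) (auto simp: K_def)
  also have "\<dots> \<le> (\<Sum>p \<in> Sigma W (\<lambda>x. edges P - {x}). hop P w (snd p) (fst p))"
    by (rule sum_mono2[OF finS]) (auto simp: K_def)
  also have "\<dots> = hops w W"
    unfolding hops_def using finW finite_edges by (subst sum.Sigma) (auto intro!: sum.cong)
  finally show ?thesis .
qed

lemma hops_Un:
  assumes "finite Q" "Q0 \<subseteq> Q"
  shows "hops w Q = hops w Q0 + hops w (Q - Q0)"
  unfolding hops_def by (subst sum.subset_diff[OF assms(2,1)]) (rule add.commute)

lemma hops_mono: "Q \<subseteq> edges P \<Longrightarrow> hops w Q \<le> hop_distance P w"
  unfolding hop_distance_eq hops_def using finite_edges by (intro sum_mono2) auto

text \<open>\<open>Og\<close> and the edges with errors together cover \<open>M\<close>: without an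
  error at \<open>f\<close>, the tree edges on its cycle weigh at most \<open>low P f\<close>, and
  if \<open>f\<close> is not in \<open>Og\<close> either, \<open>tree_edge_in_feasible\<close> puts
  \<open>e\<close> into \<open>Og\<close>.\<close>

lemma crit_matching_bound:
  assumes w: "admissible w" and Og: "feasible P w Og" and M: "M \<subseteq> crit" "matching M"
  shows "card M \<le> card Og + hop_distance P w"
proof -
  define Z where "Z = {z \<in> edges P. err w (edges P) z}"
  have finZ: "finite Z" unfolding Z_def using finite_edges by simp
  have OgE: "Og \<subseteq> edges P" using Og unfolding feasible_def by blast
  have "e \<in> Og \<union> Z \<or> f \<in> Og \<union> Z" if m: "(e, f) \<in> M" for e f
  proof (rule ccontr)
    assume "\<not> ?thesis"
    then have neg: "f \<notin> Og" "f \<notin> Z" "e \<notin> Z" "e \<notin> Og" by auto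
    have cr: "(e, f) \<in> crit" using m M by blast
    note c = critD[OF cr]
    have ne: "\<not> err w (edges P) e" "\<not> err w (edges P) f" using neg c unfolding Z_def by auto
    have "e \<in> Og"
    proof (rule tree_edge_in_feasible[OF Og w base_T c(1,7)])
      show "low P e < w g" if "exch T e g" for g
        using low_less[OF that] admissible_bounds[OF w, of g] exchD[OF that] by fastforce
      show "w g < upp P e" if g: "exch T g f" "g \<noteq> e" for g
      proof -
        have gE: "g \<in> edges P" "g \<noteq> f" using exch_edges[OF base_T g(1)] by auto
        have "hop P w f g = 0" using ne(2) gE unfolding err_def by blast
        then have "w g \<le> low P f" using hop_below pred_le_low[OF g(1)] c(8) by blast
        then show ?thesis using c(4) by linarith
      qed
      show "w f < upp P e \<or> f \<notin> Og \<and> low P f < upp P e" using neg c(4) by blast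
    qed
    then show False using neg by blast
  qed
  then have cov: "covers (Og \<union> Z) M" unfolding covers_def by blast
  have disj: "fst ` M \<inter> snd ` M = {}" using M critD(9,10) by fastforce
  have "finite Og" using OgE finite_edges finite_subset by blast
  then have "card M \<le> card (Og \<union> Z)" using card_matching_le_cover[OF M(2) cov _ disj] finZ by blast
  also have "\<dots> \<le> card Og + card Z" by (rule card_Un_le)
  also have "card Z \<le> hops w (edges P)" unfolding Z_def by (rule card_err_le) simp
  finally show ?thesis by (simp add: hop_distance_eq)
qed

end


section \<open>Accounting\<close>

definition same_on :: "'e set \<Rightarrow> ('e \<Rightarrow> real) \<Rightarrow> ('e \<Rightarrow> real) \<Rightarrow> bool" where
  "same_on Q w w' \<longleftrightarrow> (\<forall>x \<in> Q. w x = w' x)"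

lemma same_on_subset: "same_on Q w w' \<Longrightarrow> Q' \<subseteq> Q \<Longrightarrow> same_on Q' w w'"
  unfolding same_on_def by blast

lemma same_on_trans: "same_on Q w w' \<Longrightarrow> same_on Q w' w'' \<Longrightarrow> same_on Q w w''"
  unfolding same_on_def by simp

lemma same_on_refl [simp]: "same_on Q w w" unfolding same_on_def by simp

text \<open>A pair as in Koenig's theorem: since the cover contains exactly one end of each matching
  edge, both have the same size and are optimal when the graph is bipartite.\<close>

definition exact_cover :: "('a \<times> 'a) set \<Rightarrow> ('a \<times> 'a) set \<Rightarrow> 'a set \<Rightarrow> bool" where
  "exact_cover G M V \<longleftrightarrow> M \<subseteq> G \<and> matching M \<and> covers V G \<and> V \<subseteq> matched M \<and>
     (\<forall>(e, f) \<in> M. e \<in> V \<longleftrightarrow> f \<notin> V)"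

definition avoiding :: "('a \<times> 'a) set \<Rightarrow> 'a set \<Rightarrow> ('a \<times> 'a) set" where
  "avoiding M W = {(e, f) \<in> M. e \<notin> W \<and> f \<notin> W}"

lemma avoiding_mono: "W \<subseteq> W' \<Longrightarrow> avoiding M W' \<subseteq> avoiding M W"
  unfolding avoiding_def by blast

lemma matched_mono: "M \<subseteq> M' \<Longrightarrow> matched M \<subseteq> matched M'"
  unfolding matched_def by blast

context stable_instance
begin

lemma lo_cong: "same_on Q w w' \<Longrightarrow> lo Q w = lo Q w'"
  unfolding lo_def same_on_def by (rule ext) simp

lemma up_cong: "same_on Q w w' \<Longrightarrow> up Q w = up Q w'"
  unfolding up_def same_on_def by (rule ext) simp

lemma confl_cong: "same_on Q w w' \<Longrightarrow> confl S Q w = confl S Q w'"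
  unfolding confl_def using lo_cong[of Q w w'] up_cong[of Q w w'] by simp

lemma stable_cong: "same_on Q w w' \<Longrightarrow> stable S Q w = stable S Q w'"
  unfolding stable_def using confl_cong[of Q w w'] by simp

lemma low_tree_cong: "same_on Q w w' \<Longrightarrow> low_tree S Q w = low_tree S Q w'"
  unfolding low_tree_def using lo_cong[of Q w w'] by simp

lemma hop_cong: "w e = w' e \<Longrightarrow> hop P w e' e = hop P w' e' e"
  unfolding hop_def by simp

lemma hops_cong: "same_on Q w w' \<Longrightarrow> hops w Q = hops w' Q"
  unfolding hops_def same_on_def by (intro sum.cong refl hop_cong) blast

lemma err_cong: "same_on W w w' \<Longrightarrow> err w W z = err w' W z"
  unfolding err_def same_on_def using hop_cong[of w _ w'] by metis

lemma err_mono: "err w W z \<Longrightarrow> W \<subseteq> W' \<Longrightarrow> err w W' z"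
  unfolding err_def by blast

text \<open>\<open>R\<close> holds the repair queries, \<open>X\<close> the planned queries whose partner \<open>p x\<close> has not been queried by
  plan, and \<open>D\<close> the groups that have been completed.  A partner may later become a repair query.\<close>

definition robust :: "'e set \<Rightarrow> ('e \<Rightarrow> real) \<Rightarrow> 'e set \<Rightarrow> 'e set \<Rightarrow> 'e set \<Rightarrow> ('e \<Rightarrow> 'e) \<Rightarrow> bool" where
  "robust Q w D R X p \<longleftrightarrow>
     Q = D \<union> R \<union> X \<and> D \<inter> R = {} \<and> D \<inter> X = {} \<and> R \<inter> X = {} \<and> inj_on p X \<and> p ` X \<inter> (D \<union> X) = {} \<and>
     (\<forall>w' Og. admissible w' \<longrightarrow> same_on Q w w' \<longrightarrow> feasible P w' Og \<longrightarrow>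
        card D \<le> 3 * card (Og \<inter> D) \<and> card R \<le> 2 * card (Og \<inter> R) \<and> (\<forall>x \<in> X. x \<in> Og \<or> p x \<in> Og))"

lemma robust_initial: "robust {} w {} {} {} p"
  unfolding robust_def by simp

lemma robustD:
  assumes "robust Q w D R X p"
  shows "Q = D \<union> R \<union> X" "D \<inter> R = {}" "D \<inter> X = {}" "R \<inter> X = {}" "inj_on p X" "p ` X \<inter> (D \<union> X) = {}"
    "admissible w' \<Longrightarrow> same_on Q w w' \<Longrightarrow> feasible P w' Og \<Longrightarrow> card D \<le> 3 * card (Og \<inter> D)"
    "admissible w' \<Longrightarrow> same_on Q w w' \<Longrightarrow> feasible P w' Og \<Longrightarrow> card R \<le> 2 * card (Og \<inter> R)"
    "admissible w' \<Longrightarrow> same_on Q w w' \<Longrightarrow> feasible P w' Og \<Longrightarrow> x \<in> X \<Longrightarrow> x \<in> Og \<or> p x \<in> Og"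
  using assms unfolding robust_def by simp_all

lemma feasible_finite: "feasible P w Og \<Longrightarrow> finite Og"
  using finite_edges finite_subset unfolding feasible_def by blast

lemma card_three: "finite D1 \<Longrightarrow> finite D2 \<Longrightarrow> D1 \<inter> D2 = {} \<Longrightarrow> finite Og \<Longrightarrow>
  card (Og \<inter> (D1 \<union> D2)) = card (Og \<inter> D1) + card (Og \<inter> D2)"
  by (subst Int_Un_distrib, subst card_Un_disjoint) auto

lemma robust_repair:
  assumes r: "robust Q w D R X p" and A: "A \<inter> Q = {}" "finite A" "finite Q" and s: "same_on Q w w'"
    and hit: "\<And>w'' Og. admissible w'' \<Longrightarrow> same_on Q w w'' \<Longrightarrow> feasible P w'' Og \<Longrightarrow> card A \<le> 2 * card (Og \<inter> A)"
  shows "robust (Q \<union> A) w' D (R \<union> A) X p"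
proof -
  note d = robustD[OF r]
  have fin: "finite R" using d(1) A(3) by simp
  show ?thesis
    unfolding robust_def
  proof (intro conjI allI impI)
    show "Q \<union> A = D \<union> (R \<union> A) \<union> X" "D \<inter> (R \<union> A) = {}" "(R \<union> A) \<inter> X = {}" using d(1-4) A(1) by blast+
    fix w'' Og assume w'': "admissible w''" "same_on (Q \<union> A) w' w''" "feasible P w'' Og"
    have s'': "same_on Q w w''"
      using same_on_trans[OF s same_on_subset[OF w''(2)]] by blast
    have "R \<inter> A = {}" using d(1) A(1) by blast
    then show "card (R \<union> A) \<le> 2 * card (Og \<inter> (R \<union> A))"
      using d(8)[OF w''(1) s'' w''(3)] hit[OF w''(1) s'' w''(3)] fin A(2) feasible_finite[OF w''(3)]
      by (simp add: card_three card_Un_disjoint)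
    show "card D \<le> 3 * card (Og \<inter> D)" "\<forall>x\<in>X. x \<in> Og \<or> p x \<in> Og"
      using d(7,9)[OF w''(1) s'' w''(3)] by auto
  qed (use d in blast)+
qed

lemma robust_open:
  assumes r: "robust Q w D R X p" and v: "v \<notin> Q" "y \<notin> Q" "v \<noteq> y" "v \<notin> p ` X" "y \<notin> p ` X"
    and s: "same_on Q w w'"
    and hit: "\<And>w'' Og. admissible w'' \<Longrightarrow> same_on Q w w'' \<Longrightarrow> feasible P w'' Og \<Longrightarrow> v \<in> Og \<or> y \<in> Og"
  shows "robust (Q \<union> {v}) w' D R (insert v X) (p(v := y))"
proof -
  note d = robustD[OF r]
  have vX: "v \<notin> X" "v \<notin> D" "v \<notin> R" "y \<notin> X" "y \<notin> D" using d(1) v by auto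
  have im: "(p(v := y)) ` X = p ` X" using vX(1) by auto
  show ?thesis
    unfolding robust_def
  proof (intro conjI allI impI ballI)
    show "Q \<union> {v} = D \<union> R \<union> insert v X" using d(1) by blast
    show "D \<inter> R = {}" "D \<inter> insert v X = {}" "R \<inter> insert v X = {}" using d vX by auto
    show "inj_on (p(v := y)) (insert v X)" using d(5) vX(1) v(5)
      by (auto simp: inj_on_def)
    show "(p(v := y)) ` insert v X \<inter> (D \<union> insert v X) = {}"
      using d(6) vX v im by auto
    fix w'' Og assume w'': "admissible w''" "same_on (Q \<union> {v}) w' w''" "feasible P w'' Og"
    have s'': "same_on Q w w''"
      using same_on_trans[OF s same_on_subset[OF w''(2)]] by blast
    show "card D \<le> 3 * card (Og \<inter> D)" "card R \<le> 2 * card (Og \<inter> R)"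
      using d(7,8)[OF w''(1) s'' w''(3)] by auto
    fix x assume "x \<in> insert v X"
    then show "x \<in> Og \<or> (p(v := y)) x \<in> Og"
      using hit[OF w''(1) s'' w''(3)] d(9)[OF w''(1) s'' w''(3), of x] by auto
  qed
qed

text \<open>Every feasible set meets the pair \<open>x\<close>, \<open>p x\<close>; with at most one
  further query from \<open>A\<close> it becomes a group of at most three.\<close>

lemma robust_close:
  assumes r: "robust Q w D R X p" and x: "x \<in> X" "p x \<in> A" and A: "A \<inter> Q = {}" "finite A" "finite Q"
    "card A \<le> 2" "A \<inter> p ` X \<subseteq> {p x}" and s: "same_on Q w w'"
  shows "robust (Q \<union> A) w' (D \<union> insert x A) R (X - {x}) p"
proof -
  note d = robustD[OF r]
  have fin: "finite D" using d(1) A(3) by simp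
  have disj: "D \<inter> insert x A = {}" using d(1,3) A(1) x(1) by blast
  show ?thesis
    unfolding robust_def
  proof (intro conjI allI impI ballI)
    show "Q \<union> A = D \<union> insert x A \<union> R \<union> (X - {x})" using d(1) x(1) by blast
    show "(D \<union> insert x A) \<inter> R = {}" using d(1,2,4) x(1) A(1) by blast
    show "(D \<union> insert x A) \<inter> (X - {x}) = {}" using d(1,3) A(1) by blast
    show "R \<inter> (X - {x}) = {}" using d(4) by blast
    show "inj_on p (X - {x})" using d(5) by (rule inj_on_diff)
    define J where "J = p ` X"
    have "p ` (X - {x}) \<subseteq> J - {p x}" using d(5) x(1) unfolding J_def by (auto simp: inj_on_def)
    then show "p ` (X - {x}) \<inter> (D \<union> insert x A \<union> (X - {x})) = {}"
      using d(6)[folded J_def] x(1) A(5)[folded J_def] by blast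
    fix w'' Og assume w'': "admissible w''" "same_on (Q \<union> A) w' w''" "feasible P w'' Og"
    have s'': "same_on Q w w''"
      using same_on_trans[OF s same_on_subset[OF w''(2)]] by blast
    have "Og \<inter> insert x A \<noteq> {}" using d(9)[OF w''(1) s'' w''(3) x(1)] x(2) by blast
    then have "1 \<le> card (Og \<inter> insert x A)"
      using feasible_finite[OF w''(3)] by (simp add: Suc_le_eq card_gt_0_iff)
    moreover have "card (insert x A) \<le> 3" using A(2,4) by (simp add: card_insert_if)
    ultimately show "card (D \<union> insert x A) \<le> 3 * card (Og \<inter> (D \<union> insert x A))"
      using d(7)[OF w''(1) s'' w''(3)] fin A(2) disj feasible_finite[OF w''(3)]
        card_three[of D "insert x A" Og] card_Un_disjoint[of D "insert x A"] by simp
    show "card R \<le> 2 * card (Og \<inter> R)" using d(8)[OF w''(1) s'' w''(3)] .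
    fix z assume "z \<in> X - {x}"
    then show "z \<in> Og \<or> p z \<in> Og" using d(9)[OF w''(1) s'' w''(3), of z] by blast
  qed
qed

text \<open>Partners may lie in \<open>R\<close>, so \<open>R\<close> and \<open>X\<close> are
  charged to the same part \<open>B\<close> of \<open>Og\<close>, with factors two and one. The
  groups in \<open>D\<close> are charged to the disjoint part of \<open>Og\<close> in
  \<open>D\<close>, with factor three.\<close>

lemma robust_final:
  assumes r: "robust Q w D R X p" and fin: "finite Q" and w: "admissible w" and Og: "feasible P w Og"
  shows "card Q \<le> 3 * card Og"
proof -
  note d = robustD[OF r]
  have fO: "finite Og" by (rule feasible_finite[OF Og])
  have f: "finite D" "finite R" "finite X" using d(1) fin by auto
  define B where "B = Og \<inter> (R \<union> X \<union> p ` X)"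
  define g where "g x = (if x \<in> Og then x else p x)" for x
  have "inj_on g X"
    using d(5,6) unfolding g_def inj_on_def by (auto split: if_splits)
  moreover have "g ` X \<subseteq> B"
    using d(9)[OF w same_on_refl Og] unfolding g_def B_def by auto
  moreover have finB: "finite B" unfolding B_def using fO by simp
  ultimately have X: "card X \<le> card B" using card_inj_on_le by blast
  have "card (Og \<inter> R) \<le> card B" by (rule card_mono[OF finB]) (auto simp: B_def)
  then have R: "card R \<le> 2 * card B" using d(8)[OF w same_on_refl Og] by linarith
  have D: "card D \<le> 3 * card (Og \<inter> D)" using d(7)[OF w same_on_refl Og] .
  have "(Og \<inter> D) \<inter> B = {}" unfolding B_def using d(2,3,6) by blast
  then have "card (Og \<inter> D) + card B = card ((Og \<inter> D) \<union> B)"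
    using fO finB by (simp add: card_Un_disjoint)
  also have "\<dots> \<le> card Og" by (rule card_mono[OF fO]) (auto simp: B_def)
  finally have "card (Og \<inter> D) + card B \<le> card Og" .
  moreover have "card Q \<le> card D + card R + card X"
    unfolding d(1) by (meson add_le_mono1 card_Un_le order_trans)
  ultimately show ?thesis using X R D by linarith
qed

text \<open>\<open>S\<close>, \<open>M\<close> and \<open>V\<close> are the tree, matching and vertex cover for the set \<open>Q0\<close> of queries at which the last
  planned query was chosen, \<open>Cl\<close> contains the partner if it was queried along, and \<open>Y\<close> is the set of all
  partners so far.  By the last conjunct, an error-free repair query outside the cover comes together with
  an erroneous one inside the cover.\<close>

definition midway :: "nat \<Rightarrow> 'e set \<Rightarrow> ('e \<Rightarrow> real) \<Rightarrow> 'e set \<Rightarrow> 'e set \<Rightarrow> ('e \<times> 'e) set \<Rightarrow> 'e set \<Rightarrow> 'e set \<Rightarrow>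
    'e set \<Rightarrow> bool" where
  "midway \<nu> Q w S Q0 M V Cl Y \<longleftrightarrow>
     Q0 \<subseteq> Q \<and> Q \<subseteq> edges P \<and> stable S Q0 w \<and> exact_cover (confl S Q0 w) M V \<and>
     Cl \<subseteq> Q - Q0 - V \<and>
     (\<forall>(e, f) \<in> M. e \<in> Cl \<or> f \<in> Cl \<longrightarrow> e \<in> Q - Q0 - Cl \<or> f \<in> Q - Q0 - Cl) \<and>
     card Q0 + card M + card Cl + card (matched (avoiding M (Q - Q0)) \<inter> (Y - Q)) \<le> \<nu> + 3 * hops w Q0 \<and>
     card {x \<in> Q - Q0 - V - Cl. \<not> err w (Q - Q0) x} \<le> card {x \<in> (Q - Q0) \<inter> V. err w (Q - Q0) x}"

text \<open>A potential: \<open>card Q + card M\<close> counts the queries made and the planned ones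
  to come, as the cover has the size of \<open>M\<close>. The third summand counts open partners
  that \<open>M\<close> could use again, each possibly costing an extra query. \<open>\<nu>\<close>
  will be the size of the initial matching.\<close>

definition settled :: "nat \<Rightarrow> 'e set \<Rightarrow> ('e \<Rightarrow> real) \<Rightarrow> 'e set \<Rightarrow> ('e \<times> 'e) set \<Rightarrow> 'e set \<Rightarrow> 'e set \<Rightarrow> bool" where
  "settled \<nu> Q w S M V Y \<longleftrightarrow>
     Q \<subseteq> edges P \<and> low_tree S Q w \<and> stable S Q w \<and> exact_cover (confl S Q w) M V \<and>
     card Q + card M + card (matched M \<inter> (Y - Q)) \<le> \<nu> + 3 * hops w Q"

lemma stable_confl:
  assumes "stable S Q w"
  shows "finite (confl S Q w)" "fst ` confl S Q w \<inter> snd ` confl S Q w = {}"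
    "(e, f) \<in> confl S Q w \<Longrightarrow> e \<in> T \<and> f \<notin> T \<and> e \<in> unknown Q \<and> f \<in> unknown Q"
proof -
  have sub: "confl S Q w \<subseteq> crit \<inter> unknown Q \<times> unknown Q" using assms unfolding stable_def by blast
  then show c: "(e, f) \<in> confl S Q w \<Longrightarrow> e \<in> T \<and> f \<notin> T \<and> e \<in> unknown Q \<and> f \<in> unknown Q" for e f
    using critD(9,10) by blast
  have "finite (unknown Q)" unfolding unknown_def using finite_edges by simp
  then show "finite (confl S Q w)" using sub finite_subset[of _ "unknown Q \<times> unknown Q"] by blast
  show "fst ` confl S Q w \<inter> snd ` confl S Q w = {}"
  proof (rule ccontr)
    assume "\<not> ?thesis"
    then obtain z e f where "(z, f) \<in> confl S Q w" "(e, z) \<in> confl S Q w" by force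
    then show False using c by blast
  qed
qed

lemma exact_coverD:
  assumes "exact_cover G M V" "finite G" "fst ` G \<inter> snd ` G = {}"
  shows "finite M" "finite V" "card V = card M" "fst ` M \<inter> snd ` M = {}"
proof -
  have e: "M \<subseteq> G" "matching M" "V \<subseteq> matched M" "\<forall>(e, f) \<in> M. e \<in> V \<longleftrightarrow> f \<notin> V"
    using assms(1) unfolding exact_cover_def by auto
  show fM: "finite M" using e(1) assms(2) finite_subset by blast
  show d: "fst ` M \<inter> snd ` M = {}" using e(1) assms(3) by blast
  show "finite V" using e(3) fM finite_subset[of V "matched M"] unfolding matched_def by simp
  show "card V = card M" by (rule card_exact_cover[OF fM e(2-4) d])
qed

text \<open>Every edge of \<open>Z\<close> pays three units: one for a query outside the cover and
  two for the vertices newly matched by an augmentation. The pairs in \<open>M0\<close> survive by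
  \<open>conflict_survives\<close>, and only the rest has to be rebuilt.\<close>

lemma settle:
  assumes w: "admissible w" and mid: "midway \<nu> Q w S Q0 M V Cl Y" and S': "low_tree S' Q w"
    and sub: "confl S' Q w \<subseteq> confl S Q0 w \<inter> unknown Q \<times> unknown Q"
  shows "\<exists>M' V'. settled \<nu> Q w S' M' V' Y"
proof -
  have Q: "Q0 \<subseteq> Q" "Q \<subseteq> edges P" and st: "stable S Q0 w" and ec: "exact_cover (confl S Q0 w) M V"
    and Cl: "Cl \<subseteq> Q - Q0 - V"
    and tch: "\<And>e f. (e, f) \<in> M \<Longrightarrow> e \<in> Cl \<or> f \<in> Cl \<Longrightarrow> e \<in> Q - Q0 - Cl \<or> f \<in> Q - Q0 - Cl"
    and phi: "card Q0 + card M + card Cl + card (matched (avoiding M (Q - Q0)) \<inter> (Y - Q)) \<le> \<nu> + 3 * hops w Q0"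
    and bud: "card {x \<in> Q - Q0 - V - Cl. \<not> err w (Q - Q0) x} \<le> card {x \<in> (Q - Q0) \<inter> V. err w (Q - Q0) x}"
    using mid unfolding midway_def by auto
  have st': "stable S' Q w"
    using st S' sub unfolding stable_def low_tree_def by blast
  note c0 = stable_confl[OF st] and c1 = stable_confl[OF st']
  note ex = exact_coverD[OF ec c0(1,2)]
  have mM: "M \<subseteq> confl S Q0 w" "matching M" "covers V (confl S Q0 w)"
    using ec unfolding exact_cover_def by auto
  define W where "W = Q - Q0"
  define Z where "Z = {z \<in> edges P. err w W z}"
  have finQ: "finite Q" using Q finite_edges finite_subset by blast
  then have finW: "finite W" unfolding W_def by simp
  have finZ: "finite Z" unfolding Z_def using finite_edges by simp
  have WE: "W \<subseteq> edges P" unfolding W_def using Q by blast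
  define M0 where "M0 = avoiding M (W \<union> Z)"
  have M0M: "M0 \<subseteq> M" unfolding M0_def avoiding_def by blast
  have M0c: "M0 \<subseteq> confl S' Q w"
  proof clarify
    fix e f assume "(e, f) \<in> M0"
    then have ef: "(e, f) \<in> confl S Q0 w" "e \<notin> W \<union> Z" "f \<notin> W \<union> Z"
      using mM(1) unfolding M0_def avoiding_def by auto
    have u0: "e \<in> unknown Q0" "f \<in> unknown Q0" using c0(3)[OF ef(1)] by auto
    then have u: "e \<in> unknown Q" "f \<in> unknown Q" using ef(2,3) unfolding unknown_def W_def by auto
    have ne: "\<not> err w (Q - Q0) e" "\<not> err w (Q - Q0) f"
      using ef(2,3) u unfolding Z_def unknown_def W_def by auto
    show "(e, f) \<in> confl S' Q w"
      by (rule conflict_survives[OF w st Q(1) S' _ ef(1) u(1) ne(1) u(2) ne(2)]) (use sub in blast)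
  qed
  have mM0: "matching M0" using matching_subset[OF mM(2) M0M] .
  obtain M' V' where M': "M' \<subseteq> confl S' Q w" "matching M'" "matched M0 \<subseteq> matched M'"
      "covers V' (confl S' Q w)" "V' \<subseteq> matched M'" "\<forall>(e, f) \<in> M'. e \<in> V' \<longleftrightarrow> f \<notin> V'"
    using matching_extends_to_cover[OF c1(1,2) M0c mM0] by auto
  then have ec': "exact_cover (confl S' Q w) M' V'" unfolding exact_cover_def by blast
  note ex' = exact_coverD[OF ec' c1(1,2)]
  \<comment> \<open>The old cover without its queried vertices covers all new conflicts, so the
    matching shrinks at least by the number of cover vertices queried.\<close>
  have "e \<in> V - W \<or> f \<in> V - W" if "(e, f) \<in> M'" for e f
  proof -
    have "(e, f) \<in> confl S Q0 w" "e \<in> unknown Q" "f \<in> unknown Q" using that M'(1) sub by auto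
    moreover from this have "e \<notin> W" "f \<notin> W" unfolding unknown_def W_def by auto
    ultimately show ?thesis using mM(3) unfolding covers_def by auto
  qed
  then have "covers (V - W) M'" unfolding covers_def by blast
  then have "card M' \<le> card (V - W)"
    by (rule card_matching_le_cover[OF M'(2)]) (use ex(2) ex'(4) in auto)
  also have "card (V - W) = card M - card (W \<inter> V)"
    using ex(2,3) by (simp add: card_Diff_subset_Int Int_commute)
  finally have c1': "card M' + card (W \<inter> V) \<le> card M"
    using card_mono[of V "W \<inter> V"] ex(2,3) by simp
  have budZ: "card (W - V - Cl - Z) \<le> card (W \<inter> V \<inter> Z)"
  proof -
    have "W - V - Cl - Z = {x \<in> Q - Q0 - V - Cl. \<not> err w (Q - Q0) x}"
      using WE unfolding Z_def W_def by blast
    moreover have "W \<inter> V \<inter> Z = {x \<in> (Q - Q0) \<inter> V. err w (Q - Q0) x}"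
      using WE unfolding Z_def W_def by blast
    ultimately show ?thesis using bud by simp
  qed
  have WVsplit: "card (W \<inter> V) = card (W \<inter> V - Z) + card (W \<inter> V \<inter> Z)"
    using finW by (subst card_Un_disjoint[symmetric]) (auto intro: arg_cong[of _ _ card])
  \<comment> \<open>\<open>Cl\<close> may be left out of the cover because a pair touched by
    \<open>Cl\<close> is also touched by another query in \<open>W\<close>.\<close>
  have "card (M - M0) \<le> card ((W \<union> Z) - Cl)"
  proof (rule card_matching_le_cover)
    show "matching (M - M0)" using matching_subset[OF mM(2)] by blast
    show "fst ` (M - M0) \<inter> snd ` (M - M0) = {}" using ex(4) by blast
    show "covers ((W \<union> Z) - Cl) (M - M0)"
      unfolding covers_def M0_def avoiding_def using tch Cl unfolding W_def by blast
  qed (use finW finZ in simp)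
  also have "\<dots> \<le> card (Z \<union> (W \<inter> V - Z) \<union> (W - V - Cl - Z))"
    using finW finZ by (intro card_mono) auto
  also have "\<dots> \<le> card Z + card (W \<inter> V - Z) + card (W - V - Cl - Z)"
    by (meson add_le_mono1 card_Un_le order_trans)
  finally have c2: "card (M - M0) \<le> card Z + card (W \<inter> V)" using budZ WVsplit by linarith
  have c3: "card M = card M0 + card (M - M0)"
    using ex(1) M0M by (metis card_Diff_subset card_mono finite_subset le_add_diff_inverse)
  have "card W \<le> card ((W \<inter> V) \<union> Cl \<union> (W - V - Cl - Z) \<union> ((W - V) \<inter> Z))"
    using finW Cl unfolding W_def by (intro card_mono) (auto intro: finite_subset)
  also have "\<dots> \<le> card (W \<inter> V) + card Cl + card (W - V - Cl - Z) + card ((W - V) \<inter> Z)"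
    by (meson add_le_mono1 card_Un_le order_trans)
  finally have "card W \<le> card (W \<inter> V) + card Cl + (card (W \<inter> V \<inter> Z) + card ((W - V) \<inter> Z))"
    using budZ by linarith
  also have "card (W \<inter> V \<inter> Z) + card ((W - V) \<inter> Z) \<le> card Z"
    using finZ by (subst card_Un_disjoint[symmetric]) (auto intro: card_mono)
  finally have c4: "card W \<le> card (W \<inter> V) + card Cl + card Z" by simp
  have fm': "finite (matched M')" unfolding matched_def using ex'(1) by simp
  have "matched M' \<inter> (Y - Q) \<subseteq> matched M0 \<inter> (Y - Q) \<union> (matched M' - matched M0)" by blast
  then have "card (matched M' \<inter> (Y - Q)) \<le> card (matched M0 \<inter> (Y - Q) \<union> (matched M' - matched M0))"
    using fm' finite_subset[OF M'(3) fm'] by (intro card_mono) auto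
  also have "\<dots> \<le> card (matched M0 \<inter> (Y - Q)) + card (matched M' - matched M0)" by (rule card_Un_le)
  also have "card (matched M' - matched M0) = 2 * card M' - 2 * card M0"
  proof -
    have "card (matched M0) = 2 * card M0"
      by (rule card_matched[OF finite_subset[OF M0M ex(1)] mM0]) (use M0M ex(4) in blast)
    moreover have "card (matched M') = 2 * card M'" by (rule card_matched[OF ex'(1) M'(2) ex'(4)])
    ultimately show ?thesis using M'(3) fm' by (simp add: card_Diff_subset finite_subset)
  qed
  also have "card (matched M0 \<inter> (Y - Q)) \<le> card (matched (avoiding M W) \<inter> (Y - Q))"
  proof (rule card_mono)
    have "matched (avoiding M W) \<subseteq> matched M" by (rule matched_mono) (auto simp: avoiding_def)
    then show "finite (matched (avoiding M W) \<inter> (Y - Q))"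
      using ex(1) unfolding matched_def by (auto intro: finite_subset)
    show "matched M0 \<inter> (Y - Q) \<subseteq> matched (avoiding M W) \<inter> (Y - Q)"
      using matched_mono[OF avoiding_mono[of W "W \<union> Z" M]] unfolding M0_def by blast
  qed
  finally have c5: "card (matched M' \<inter> (Y - Q)) \<le>
    card (matched (avoiding M W) \<inter> (Y - Q)) + (2 * card M' - 2 * card M0)" by simp
  have c6: "card Q = card Q0 + card W"
    unfolding W_def using Q(1) finQ
    by (metis card_Diff_subset card_mono finite_subset le_add_diff_inverse)
  have "card Z \<le> hops w W" unfolding Z_def by (rule card_err_le[OF WE])
  then have c7: "hops w Q0 + card Z \<le> hops w Q" using hops_Un[OF finQ Q(1), of w] unfolding W_def by simp
  \<comment> \<open>By \<open>c1'\<close>, \<open>c2\<close> and \<open>c3\<close> the number of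
    augmentations \<open>card M' - card M0\<close> is at most \<open>card Z\<close>, so the last
    summand of \<open>c5\<close> is at most \<open>2 * card Z\<close>.\<close>
  have "card Q + card M' + card (matched M' \<inter> (Y - Q)) \<le> \<nu> + 3 * hops w Q"
    using c1' c2 c3 c4 c5 c6 c7 phi unfolding W_def[symmetric] by linarith
  then show ?thesis using Q(2) S' st' ec' unfolding settled_def by blast
qed

text \<open>The pair from \<open>unexpected_conflict_has_error\<close> is queried, or
  \<open>e\<close> alone if \<open>f\<close> is known. Every feasible set contains at least half of
  these queries.\<close>

lemma repair:
  assumes w: "admissible w" and mid: "midway \<nu> Q w S Q0 M V Cl (p ` X)" and r: "robust Q w D R X p"
    and S': "low_tree S' Q w"
    and un: "\<not> confl S' Q w \<subseteq> confl S Q0 w \<inter> unknown Q \<times> unknown Q"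
  shows "\<exists>A. A \<noteq> {} \<and> A \<subseteq> edges P - Q \<and> (\<forall>w'. admissible w' \<longrightarrow> same_on Q w w' \<longrightarrow>
    midway \<nu> (Q \<union> A) w' S Q0 M V Cl (p ` X) \<and> robust (Q \<union> A) w' D (R \<union> A) X p)"
proof -
  have Q: "Q0 \<subseteq> Q" "Q \<subseteq> edges P" and st: "stable S Q0 w" and ec: "exact_cover (confl S Q0 w) M V"
    and Cl: "Cl \<subseteq> Q - Q0 - V"
    and tch: "\<forall>(e, f) \<in> M. e \<in> Cl \<or> f \<in> Cl \<longrightarrow> e \<in> Q - Q0 - Cl \<or> f \<in> Q - Q0 - Cl"
    and phi: "card Q0 + card M + card Cl + card (matched (avoiding M (Q - Q0)) \<inter> (p ` X - Q)) \<le> \<nu> + 3 * hops w Q0"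
    and bud: "card {x \<in> Q - Q0 - V - Cl. \<not> err w (Q - Q0) x} \<le> card {x \<in> (Q - Q0) \<inter> V. err w (Q - Q0) x}"
    using mid unfolding midway_def by auto
  have finQ: "finite Q" using Q finite_edges finite_subset by blast
  note c0 = stable_confl[OF st]
  note ex = exact_coverD[OF ec c0(1,2)]
  obtain e f where ef: "(e, f) \<in> confl S' Q w" "e \<in> unknown Q" "\<And>g. exch S' g f \<Longrightarrow> up Q w g \<le> up Q w e"
    "f \<notin> unknown Q \<Longrightarrow> err w (Q - Q0) e" "f \<in> unknown Q \<Longrightarrow> err w (Q - Q0) f"
    "f \<in> unknown Q \<Longrightarrow> err w (Q - Q0) e \<or> (e, f) \<in> confl S Q0 w"
    using unexpected_conflict_has_error[OF w st Q(1) S' un] by metis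
  define A where "A = (if f \<in> unknown Q then {e, f} else {e})"
  have A: "A \<noteq> {}" "A \<subseteq> edges P - Q" "finite A" "A \<inter> Q = {}" "card A \<le> 2"
    using ef(2) unfolding A_def unknown_def by (auto simp: card_insert_if)
  have hit: "card A \<le> 2 * card (Og \<inter> A)"
    if w'': "admissible w''" "same_on Q w w''" "feasible P w'' Og" for w'' Og
  proof -
    have "e \<in> Og \<or> f \<in> unknown Q \<and> f \<in> Og"
    proof (rule max_conflict_witness[OF w''(1) _ _ ef(2) _ w''(3)])
      show "low_tree S' Q w''" using S' low_tree_cong[OF w''(2)] by simp
      show "(e, f) \<in> confl S' Q w''" using ef(1) confl_cong[OF w''(2)] by simp
      show "up Q w'' g \<le> lo Q w'' f \<or> up Q w'' g \<le> up Q w'' e" if "exch S' g f" for g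
        using ef(3)[OF that] up_cong[OF w''(2)] by simp
    qed
    then have "Og \<inter> A \<noteq> {}" unfolding A_def by auto
    then have "1 \<le> card (Og \<inter> A)" using A(3) by (simp add: Suc_le_eq card_gt_0_iff)
    then show ?thesis using A(5) by linarith
  qed
  have "midway \<nu> (Q \<union> A) w' S Q0 M V Cl (p ` X)" if w': "admissible w'" "same_on Q w w'" for w'
  proof -
    define W where "W = Q - Q0"
    have W': "Q \<union> A - Q0 = W \<union> A" unfolding W_def using A(4) Q(1) by blast
    have WA: "W \<inter> A = {}" "finite W" unfolding W_def using A(4) finQ by auto
    have s0: "same_on Q0 w w'" "same_on W w w'" using same_on_subset[OF w'(2)] Q(1) unfolding W_def by auto
    have em: "err w' (W \<union> A) z" if "err w W z" for z
      using that err_cong[OF s0(2)] err_mono[of w' W z "W \<union> A"] by blast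
    let ?L = "{x \<in> W - V - Cl. \<not> err w W x}" and ?R = "{x \<in> W \<inter> V. err w W x}"
    let ?L' = "{x \<in> W \<union> A - V - Cl. \<not> err w' (W \<union> A) x}" and ?R' = "{x \<in> (W \<union> A) \<inter> V. err w' (W \<union> A) x}"
    have fin: "finite ?L" "finite ?R'" using WA A(3) by auto
    have le: "card ?L \<le> card ?R" using bud unfolding W_def by simp
    have "card ?L' \<le> card ?R'"
    \<comment> \<open>The left side grows only by an error-free query outside the cover. This can
      only be \<open>e\<close>; then \<open>f\<close> is erroneous and belongs to the cover, so the
      right side grows too.\<close>
    proof (cases "err w W e \<or> e \<in> V")
      case True
      then have "\<And>x. x \<in> A \<Longrightarrow> err w W x \<or> x \<in> V" using ef(5) unfolding A_def W_def by (auto split: if_splits)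
      then have "?L' \<subseteq> ?L" "?R \<subseteq> ?R'" using em by blast+
      then have "card ?L' \<le> card ?L" "card ?R \<le> card ?R'" using fin by (auto intro: card_mono)
      then show ?thesis using le by linarith
    next
      case False
      then have fu: "f \<in> unknown Q" using ef(4) unfolding W_def by blast
      have fe: "err w W f" "(e, f) \<in> confl S Q0 w" using False ef(5,6)[OF fu] unfolding W_def by auto
      have fV: "f \<in> V" using fe(2) False ec unfolding exact_cover_def covers_def by blast
      have fA: "A = {e, f}" using fu unfolding A_def by simp
      have "f \<notin> W" using WA(1) fA by blast
      have "?L' \<subseteq> insert e ?L" using em fe(1) fA by blast
      then have "card ?L' \<le> Suc (card ?L)"
        using card_mono[of "insert e ?L" ?L'] fin by (simp add: card_insert_if split: if_splits)
      moreover have "insert f ?R \<subseteq> ?R'" using em fe(1) fA fV by blast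
      then have "card (insert f ?R) \<le> card ?R'" using fin by (intro card_mono)
      moreover have "card (insert f ?R) = Suc (card ?R)" using \<open>f \<notin> W\<close> WA(2) by simp
      ultimately show ?thesis using le by linarith
    qed
    moreover have "card (matched (avoiding M (W \<union> A)) \<inter> (p ` X - (Q \<union> A))) \<le>
        card (matched (avoiding M W) \<inter> (p ` X - Q))"
    proof (rule card_mono)
      have "matched (avoiding M W) \<subseteq> matched M" by (rule matched_mono) (auto simp: avoiding_def)
      then show "finite (matched (avoiding M W) \<inter> (p ` X - Q))"
        using ex(1) unfolding matched_def by (auto intro: finite_subset)
      show "matched (avoiding M (W \<union> A)) \<inter> (p ` X - (Q \<union> A)) \<subseteq> matched (avoiding M W) \<inter> (p ` X - Q)"
        using matched_mono[OF avoiding_mono[of W "W \<union> A" M]] by blast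
    qed
    then have "card Q0 + card M + card Cl + card (matched (avoiding M (W \<union> A)) \<inter> (p ` X - (Q \<union> A)))
        \<le> \<nu> + 3 * hops w' Q0"
      using phi hops_cong[OF s0(1)] unfolding W_def[symmetric] by linarith
    moreover have "\<forall>(e, f) \<in> M. e \<in> Cl \<or> f \<in> Cl \<longrightarrow> e \<in> W \<union> A - Cl \<or> f \<in> W \<union> A - Cl"
      using tch unfolding W_def by blast
    moreover have "Cl \<subseteq> W \<union> A - V" using Cl unfolding W_def by blast
    moreover have "stable S Q0 w'" "exact_cover (confl S Q0 w') M V"
      using st ec stable_cong[OF s0(1)] confl_cong[OF s0(1)] by auto
    moreover have "Q0 \<subseteq> Q \<union> A" "Q \<union> A \<subseteq> edges P" using Q A(2) by auto
    ultimately show ?thesis unfolding midway_def W' by blast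
  qed
  moreover have "robust (Q \<union> A) w' D (R \<union> A) X p" if "admissible w'" "same_on Q w w'" for w'
    by (rule robust_repair[OF r A(4,3) finQ that(2) hit])
  ultimately show ?thesis using A(1,2) by blast
qed

text \<open>Nontree vertices of the cover come first, by increasing lower limit, then tree vertices
  by decreasing upper limit. As the partner \<open>y\<close> is not in the cover, all its conflicts
  end in the cover, so \<open>v\<close> is extremal among them and one of the two witness lemmas
  applies.\<close>

lemma planned_witness:
  assumes set: "settled \<nu> Q w S M V Y" and ne: "confl S Q w \<noteq> {}"
  shows "\<exists>v y. v \<in> V \<and> y \<notin> V \<and> ((v, y) \<in> M \<or> (y, v) \<in> M) \<and>
    (\<forall>w' Og. admissible w' \<longrightarrow> same_on Q w w' \<longrightarrow> feasible P w' Og \<longrightarrow> v \<in> Og \<or> y \<in> Og)"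
proof -
  have S: "low_tree S Q w" and st: "stable S Q w" and ec: "exact_cover (confl S Q w) M V"
    using set unfolding settled_def by auto
  note c = stable_confl[OF st]
  note ex = exact_coverD[OF ec c(1,2)]
  have M: "M \<subseteq> confl S Q w" "matching M" "covers V (confl S Q w)" "V \<subseteq> matched M"
    "\<And>e f. (e, f) \<in> M \<Longrightarrow> e \<in> V \<longleftrightarrow> f \<notin> V"
    using ec unfolding exact_cover_def by auto
  have "V \<noteq> {}" using ne M(3) unfolding covers_def by fastforce
  show ?thesis
  proof (cases "V \<subseteq> T")
    case False
    then obtain v where v: "v \<in> V - T" "\<And>u. u \<in> V - T \<Longrightarrow> low P v \<le> low P u"
      using arg_min_if_finite[of "V - T" "low P"] ex(2)
      by (metis Diff_eq_empty_iff finite_Diff linorder_not_less)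
    have "v \<notin> fst ` M" using v(1) M(1) c(3) by force
    then obtain y where y: "(y, v) \<in> M" using v(1) M(4) unfolding matched_def by force
    have yV: "y \<notin> V" using M(5)[OF y] v(1) by blast
    have "y \<in> Og \<or> v \<in> Og" if w': "admissible w'" "same_on Q w w'" "feasible P w' Og" for w' Og
    proof (rule min_conflict_witness[OF w'(1) _ _ _ w'(3)])
      show "stable S Q w'" using st stable_cong[OF w'(2)] by simp
      show "(y, v) \<in> confl S Q w'" using y M(1) confl_cong[OF w'(2)] by auto
      show "low P v \<le> low P g" if "(y, g) \<in> confl S Q w'" for g
      proof -
        have yg: "(y, g) \<in> confl S Q w" using that confl_cong[OF w'(2)] by simp
        then have "g \<in> V" "g \<notin> T" using M(3) yV c(3) unfolding covers_def by auto
        then show ?thesis using v(2) by blast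
      qed
    qed
    then show ?thesis using v(1) yV y by blast
  next
    case True
    obtain v where v: "v \<in> V" "\<And>u. u \<in> V \<Longrightarrow> upp P u \<le> upp P v"
    proof -
      have "Max (upp P ` V) \<in> upp P ` V" using ex(2) \<open>V \<noteq> {}\<close> by simp
      then obtain v where "v \<in> V" "upp P v = Max (upp P ` V)" by auto
      then show ?thesis using that[of v] ex(2) by simp
    qed
    have "v \<notin> snd ` M" using v(1) True M(1) c(3) by force
    then obtain y where y: "(v, y) \<in> M" using v(1) M(4) unfolding matched_def by force
    have yV: "y \<notin> V" using M(5)[OF y] v(1) by blast
    have vy: "(v, y) \<in> confl S Q w" using y M(1) by blast
    have "v \<in> Og \<or> y \<in> Og" if w': "admissible w'" "same_on Q w w'" "feasible P w' Og" for w' Og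
    proof -
      have "v \<in> Og \<or> y \<in> unknown Q \<and> y \<in> Og"
      proof (rule max_conflict_witness[OF w'(1) _ _ _ _ w'(3)])
        show "low_tree S Q w'" using S low_tree_cong[OF w'(2)] by simp
        show "(v, y) \<in> confl S Q w'" using vy confl_cong[OF w'(2)] by simp
        show vu: "v \<in> unknown Q" using c(3)[OF vy] by blast
        show "up Q w' g \<le> lo Q w' y \<or> up Q w' g \<le> up Q w' v" if g: "exch S g y" for g
        proof (cases "(g, y) \<in> confl S Q w")
          case True
          then have "g \<in> V" "g \<in> unknown Q" using M(3) yV c(3) unfolding covers_def by auto
          then show ?thesis using v(2)[of g] unknown_limits[of g Q w'] unknown_limits[OF vu, of w'] by simp
        next
          case False
          then have "up Q w g \<le> lo Q w y" using g unfolding confl_def by auto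
          then show ?thesis using lo_cong[OF w'(2)] up_cong[OF w'(2)] by simp
        qed
      qed
      then show ?thesis by blast
    qed
    then show ?thesis using v(1) yV y by blast
  qed
qed

lemma midway_restart:
  assumes set: "settled \<nu> Q w S M V Y" and s: "same_on Q w w'"
    and A: "A \<subseteq> edges P - Q" and Cl: "Cl \<subseteq> A - V" "A \<subseteq> V \<union> Cl"
    and tch: "\<forall>(e, f) \<in> M. e \<in> Cl \<or> f \<in> Cl \<longrightarrow> e \<in> A - Cl \<or> f \<in> A - Cl"
    and card: "card Cl + card (matched (avoiding M A) \<inter> (Y' - (Q \<union> A))) \<le> card (matched M \<inter> (Y - Q))"
  shows "midway \<nu> (Q \<union> A) w' S Q M V Cl Y'"
proof -
  have QA: "Q \<union> A - Q = A" using A by blast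
  have "stable S Q w'" "exact_cover (confl S Q w') M V" "Q \<subseteq> edges P"
    "card Q + card M + card (matched M \<inter> (Y - Q)) \<le> \<nu> + 3 * hops w' Q"
    using set stable_cong[OF s] confl_cong[OF s] hops_cong[OF s] unfolding settled_def by auto
  moreover have "{x \<in> A - V - Cl. \<not> err w' A x} = {}" using Cl(2) by blast
  then have "card {x \<in> A - V - Cl. \<not> err w' A x} = 0" by (metis card.empty)
  then have "card {x \<in> A - V - Cl. \<not> err w' A x} \<le> card {x \<in> A \<inter> V. err w' A x}" by linarith
  moreover have "Q \<subseteq> Q \<union> A" "Q \<union> A \<subseteq> edges P" using A calculation(3) by blast+
  moreover have "card Q + card M + card Cl + card (matched (avoiding M A) \<inter> (Y' - (Q \<union> A))) \<le> \<nu> + 3 * hops w' Q"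
    using card calculation(4) by linarith
  ultimately show ?thesis unfolding midway_def QA using Cl(1) tch by blast
qed

lemma planned_step:
  assumes w: "admissible w" and set: "settled \<nu> Q w S M V (p ` X)" and r: "robust Q w D R X p"
    and ne: "confl S Q w \<noteq> {}"
  shows "\<exists>A. A \<noteq> {} \<and> A \<subseteq> edges P - Q \<and> (\<forall>w'. admissible w' \<longrightarrow> same_on Q w w' \<longrightarrow>
    (\<exists>Cl D' X' p'. midway \<nu> (Q \<union> A) w' S Q M V Cl (p' ` X') \<and> robust (Q \<union> A) w' D' R X' p'))"
proof -
  have QE: "Q \<subseteq> edges P" and st: "stable S Q w" and ec: "exact_cover (confl S Q w) M V"
    using set unfolding settled_def by auto
  have finQ: "finite Q" using QE finite_edges finite_subset by blast
  note c = stable_confl[OF st]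
  note ex = exact_coverD[OF ec c(1,2)]
  have M: "M \<subseteq> confl S Q w" "matching M" using ec unfolding exact_cover_def by auto
  obtain v y where v: "v \<in> V" "y \<notin> V" "(v, y) \<in> M \<or> (y, v) \<in> M" and
    hit: "\<And>w' Og. admissible w' \<Longrightarrow> same_on Q w w' \<Longrightarrow> feasible P w' Og \<Longrightarrow> v \<in> Og \<or> y \<in> Og"
    using planned_witness[OF set ne] by blast
  have vy: "v \<notin> Q" "y \<notin> Q" "v \<in> edges P" "y \<in> edges P" "v \<noteq> y"
    using v M(1) c(3) unfolding unknown_def by blast+
  have only: "a = v \<or> b = v" if "(a, b) \<in> M" "a = y \<or> b = y" for a b
    using that v(3) M(2) ex(4) matchingD1[OF M(2)] matchingD2[OF M(2)] by (metis IntI empty_iff fst_conv image_eqI snd_conv)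
  have yav: "y \<notin> matched (avoiding M A)" if "v \<in> A" for A
    using only that unfolding matched_def avoiding_def by force
  have avM: "matched (avoiding M A) \<subseteq> matched M" for A
    by (rule matched_mono) (auto simp: avoiding_def)
  have finm: "finite (matched M)" unfolding matched_def using ex(1) by simp
  have yM: "y \<in> matched M" using v(3) unfolding matched_def by force
  show ?thesis
  \<comment> \<open>An open partner \<open>v\<close> of some \<open>x\<close> is itself the next
    planned query; it completes the group of \<open>x\<close> and no new pair is opened.\<close>
  proof (cases "v \<in> p ` X")
    case True
    then obtain x where x: "x \<in> X" "v = p x" by blast
    have "midway \<nu> (Q \<union> {v}) w' S Q M V {} (p ` (X - {x})) \<and>
        robust (Q \<union> {v}) w' (D \<union> insert x {v}) R (X - {x}) p" if s: "same_on Q w w'" for w'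
    proof
      show "midway \<nu> (Q \<union> {v}) w' S Q M V {} (p ` (X - {x}))"
        by (rule midway_restart[OF set s]) (use vy v(1) avM finm in \<open>auto intro!: card_mono\<close>)
      show "robust (Q \<union> {v}) w' (D \<union> insert x {v}) R (X - {x}) p"
        by (rule robust_close[OF r x(1) _ _ _ finQ _ _ s]) (use x vy in auto)
    qed
    then show ?thesis using vy by (intro exI[of _ "{v}"]) blast
  next
    case vY: False
    show ?thesis
    proof (cases "y \<in> p ` X")
      case False
      have im: "(p(v := y)) ` insert v X = insert y (p ` X)"
        using vy(1) robustD(1)[OF r] by auto
      have "midway \<nu> (Q \<union> {v}) w' S Q M V {} ((p(v := y)) ` insert v X) \<and>
          robust (Q \<union> {v}) w' D R (insert v X) (p(v := y))" if s: "same_on Q w w'" for w'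
      proof
        \<comment> \<open>Although \<open>y\<close> joins the partners, it does not count in the
          potential: its only pair in \<open>M\<close> contains the queried
          \<open>v\<close>.\<close>
        have "matched (avoiding M {v}) \<inter> (insert y (p ` X) - (Q \<union> {v})) \<subseteq> matched M \<inter> (p ` X - Q)"
          using yav[of "{v}"] avM by blast
        then have "card (matched (avoiding M {v}) \<inter> (insert y (p ` X) - (Q \<union> {v}))) \<le> card (matched M \<inter> (p ` X - Q))"
          using finm by (intro card_mono) auto
        then show "midway \<nu> (Q \<union> {v}) w' S Q M V {} ((p(v := y)) ` insert v X)"
          unfolding im by (intro midway_restart[OF set s]) (use vy v(1) in auto)
        show "robust (Q \<union> {v}) w' D R (insert v X) (p(v := y))"
          by (rule robust_open[OF r vy(1,2,5) vY False s hit])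
      qed
      then show ?thesis using vy by (intro exI[of _ "{v}"]) blast
    next
      case True
      then obtain x where x: "x \<in> X" "y = p x" by blast
      have "midway \<nu> (Q \<union> {v, y}) w' S Q M V {y} (p ` (X - {x})) \<and>
          robust (Q \<union> {v, y}) w' (D \<union> insert x {v, y}) R (X - {x}) p" if s: "same_on Q w w'" for w'
      proof
        \<comment> \<open>Querying \<open>y\<close> removes it from the open partners counted
          before, which pays for the extra query in \<open>Cl\<close>.\<close>
        have "insert y (matched (avoiding M {v, y}) \<inter> (p ` (X - {x}) - (Q \<union> {v, y}))) \<subseteq> matched M \<inter> (p ` X - Q)"
          using avM yM True vy by blast
        then have "card (insert y (matched (avoiding M {v, y}) \<inter> (p ` (X - {x}) - (Q \<union> {v, y})))) \<le>
            card (matched M \<inter> (p ` X - Q))"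
          using finm by (intro card_mono) auto
        moreover have "finite (matched (avoiding M {v, y}))" using finm avM finite_subset by blast
        ultimately have "card {y} + card (matched (avoiding M {v, y}) \<inter> (p ` (X - {x}) - (Q \<union> {v, y}))) \<le>
            card (matched M \<inter> (p ` X - Q))"
          by simp
        then show "midway \<nu> (Q \<union> {v, y}) w' S Q M V {y} (p ` (X - {x}))"
          by (intro midway_restart[OF set s]) (use vy v only in auto)
        show "robust (Q \<union> {v, y}) w' (D \<union> insert x {v, y}) R (X - {x}) p"
          by (rule robust_close[OF r x(1) _ _ _ finQ _ _ s]) (use x vy vY in auto)
      qed
      then show ?thesis using vy by (intro exI[of _ "{v, y}"]) blast
    qed
  qed
qed

end


section \<open>The query game\<close>

text \<open>Winning positions of a player who must keep to the bound \<open>B\<close> for every weight function that is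
  consistent with the answers so far.\<close>

inductive wins :: "(('v, 'e) problem \<Rightarrow> ('e \<Rightarrow> real) \<Rightarrow> real) \<Rightarrow> ('v, 'e) problem \<Rightarrow> 'e set \<Rightarrow> ('e \<Rightarrow> real) \<Rightarrow> bool"
  for B :: "('v, 'e) problem \<Rightarrow> ('e \<Rightarrow> real) \<Rightarrow> real" and P :: "('v, 'e) problem" where
  stop: "feasible P w Q \<Longrightarrow>
    (\<And>w'. valid_instance P w' \<Longrightarrow> same_on Q w w' \<Longrightarrow> real (card Q) \<le> B P w') \<Longrightarrow> wins B P Q w"
| query: "e \<in> edges P - Q \<Longrightarrow>
    (\<And>w'. valid_instance P w' \<Longrightarrow> same_on Q w w' \<Longrightarrow> wins B P (insert e Q) w') \<Longrightarrow> wins B P Q w"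

lemma wins_card_le:
  assumes "wins B P Q w" "valid_instance P w"
  shows "real (card Q) \<le> B P w"
  using assms
proof (induction rule: wins.induct)
  case (query e Q w)
  have "real (card (insert e Q)) \<le> B P w" using query by simp
  moreover have "card Q \<le> card (insert e Q)" by (rule card_insert_le)
  ultimately show ?case by linarith
qed simp

text \<open>The edges of \<open>A\<close> are queried one after another, whatever the intermediate
  answers are.\<close>

lemma wins_batch:
  assumes "finite A" "A \<subseteq> edges P - Q" "valid_instance P w"
    and "\<And>w'. valid_instance P w' \<Longrightarrow> same_on Q w w' \<Longrightarrow> wins B P (Q \<union> A) w'"
  shows "wins B P Q w"
  using assms
proof (induction A arbitrary: Q w rule: finite_induct)
  case empty
  then show ?case by simp
next
  case (insert a A)
  show ?case
  proof (rule wins.query[of a])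
    show "a \<in> edges P - Q" using insert.prems by blast
    fix w' assume w': "valid_instance P w'" "same_on Q w w'"
    show "wins B P (insert a Q) w'"
    proof (rule insert.IH)
      show "A \<subseteq> edges P - insert a Q" using insert.hyps insert.prems by blast
      fix w'' assume w'': "valid_instance P w''" "same_on (insert a Q) w' w''"
      have "same_on Q w w''" using w'(2) w''(2) unfolding same_on_def by simp
      then have "wins B P (Q \<union> insert a A) w''" using insert.prems(3) w''(1) by blast
      then show "wins B P (insert a Q \<union> A) w''" by simp
    qed (rule w'(1))
  qed
qed

text \<open>The condition ranges over all valid weights consistent with the history, so the choice
  depends on the history alone and not on hidden weights.\<close>

definition winning_query :: "(('v, 'e) problem \<Rightarrow> ('e \<Rightarrow> real) \<Rightarrow> real) \<Rightarrow> ('v, 'e) algorithm" where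
  "winning_query B P h = (SOME e. e \<in> edges P - fst ` set h \<and>
     (\<forall>w'. valid_instance P w' \<longrightarrow> (\<forall>(x, r) \<in> set h. w' x = r) \<longrightarrow> wins B P (insert e (fst ` set h)) w'))"

text \<open>At a winning position whose query set is not feasible, only the rule
  \<open>query\<close> applies, and the chosen edge leads to a winning position again. Each query is
  new, so a feasible set is reached, where \<open>wins_card_le\<close> gives the bound.\<close>

lemma winning_query_competitive:
  assumes "\<And>P w. (P, w) \<in> C \<Longrightarrow> valid_instance P w \<and> wins (\<lambda>P w. \<rho> P w * real (opt P w)) P {} w"
  shows "competitive (winning_query (\<lambda>P w. \<rho> P w * real (opt P w))) \<rho> C"
  unfolding competitive_def
proof (clarify)
  fix P w assume "(P, w) \<in> C"
  define B where "B = (\<lambda>(P :: ('a, 'b) problem) w. \<rho> P w * real (opt P w))"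
  have valid: "valid_instance P w" and start: "wins B P {} w"
    using assms[OF \<open>(P, w) \<in> C\<close>] unfolding B_def by auto
  define Q where "Q n = queried (winning_query B) P w n" for n
  have inv: "(\<forall>(x, r) \<in> set (transcript (winning_query B) P w n). r = w x) \<and> wins B P (Q n) w \<and> Q n \<subseteq> edges P \<and>
      (feasible P w (Q n) \<or> (\<exists>e. e \<in> edges P - Q n \<and> Q (Suc n) = insert e (Q n)))" for n
  proof (induction n)
    have step: "(\<forall>(x, r) \<in> set (transcript (winning_query B) P w (Suc n)). r = w x) \<and> wins B P (Q (Suc n)) w \<and>
        Q (Suc n) \<subseteq> edges P \<and>
        (feasible P w (Q n) \<or> (\<exists>e. e \<in> edges P - Q n \<and> Q (Suc n) = insert e (Q n)))"
      if n: "\<forall>(x, r) \<in> set (transcript (winning_query B) P w n). r = w x" "wins B P (Q n) w" "Q n \<subseteq> edges P" for n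
    proof -
      define h where "h = transcript (winning_query B) P w n"
      have Qh: "Q n = fst ` set h" unfolding Q_def queried_def h_def ..
      show ?thesis
      proof (cases "feasible P w (Q n)")
        case True
        then have "transcript (winning_query B) P w (Suc n) = transcript (winning_query B) P w n"
          unfolding Qh h_def by (simp add: Let_def)
        moreover from this have "Q (Suc n) = Q n" unfolding Q_def queried_def by simp
        ultimately show ?thesis using n True by simp
      next
        case False
        have eqv: "same_on (Q n) w w' \<longleftrightarrow> (\<forall>(x, r) \<in> set h. w' x = r)" for w'
          using n(1) unfolding Qh h_def[symmetric] same_on_def by fastforce
        from n(2) False obtain e where "e \<in> edges P - Q n"
          "\<And>w'. valid_instance P w' \<Longrightarrow> same_on (Q n) w w' \<Longrightarrow> wins B P (insert e (Q n)) w'"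
          by (cases rule: wins.cases) auto
        then have "\<exists>e. e \<in> edges P - fst ` set h \<and>
          (\<forall>w'. valid_instance P w' \<longrightarrow> (\<forall>(x, r) \<in> set h. w' x = r) \<longrightarrow> wins B P (insert e (fst ` set h)) w')"
          unfolding Qh[symmetric] eqv[symmetric] by blast
        then have a: "winning_query B P h \<in> edges P - Q n"
          "\<And>w'. valid_instance P w' \<Longrightarrow> same_on (Q n) w w' \<Longrightarrow> wins B P (insert (winning_query B P h) (Q n)) w'"
          unfolding Qh[symmetric] eqv[symmetric] using someI_ex[of "\<lambda>e. e \<in> edges P - Q n \<and>
            (\<forall>w'. valid_instance P w' \<longrightarrow> same_on (Q n) w w' \<longrightarrow> wins B P (insert e (Q n)) w')"]
          unfolding winning_query_def Qh[symmetric] eqv[symmetric] by blast+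
        have t: "transcript (winning_query B) P w (Suc n) = h @ [(winning_query B P h, w (winning_query B P h))]"
          using False unfolding Qh h_def by (simp add: Let_def)
        then have QS: "Q (Suc n) = insert (winning_query B P h) (Q n)"
          unfolding Qh unfolding Q_def queried_def by simp
        have "\<forall>(x, r) \<in> set (transcript (winning_query B) P w (Suc n)). r = w x"
          unfolding t using n(1) unfolding h_def[symmetric] by auto
        then show ?thesis using QS a(1) a(2)[OF valid same_on_refl] n(3) by auto
      qed
    qed
    {
      case 0
      have "Q 0 = {}" unfolding Q_def queried_def by simp
      then show ?case using step[of 0] start by simp
    next
      case (Suc n)
      then show ?case using step[of n] step[of "Suc n"] by blast
    }
  qed
  have finE: "finite (edges P)" using valid unfolding valid_instance_def by blast
  have "\<exists>n. feasible P w (Q n)"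
  proof (rule ccontr)
    assume no: "\<not> ?thesis"
    have "card (Q n) = n" for n
    proof (induction n)
      case 0
      show ?case unfolding Q_def queried_def by simp
    next
      case (Suc n)
      obtain e where "e \<in> edges P - Q n" "Q (Suc n) = insert e (Q n)" using inv[of n] no by blast
      then show ?case using Suc inv[of n] finite_subset[OF _ finE] by simp
    qed
    then have "Suc (card (edges P)) \<le> card (edges P)"
      using inv[of "Suc (card (edges P))"] card_mono[OF finE] by metis
    then show False by simp
  qed
  then obtain n where n: "feasible P w (Q n)" by blast
  moreover have "real (card (Q n)) \<le> \<rho> P w * real (opt P w)"
    using wins_card_le[of B P "Q n" w] inv[of n] valid unfolding B_def by simp
  ultimately show "\<exists>n. feasible P w (queried (winning_query (\<lambda>P w. \<rho> P w * real (opt P w))) P w n) \<and>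
      real (card (queried (winning_query (\<lambda>P w. \<rho> P w * real (opt P w))) P w n)) \<le> \<rho> P w * real (opt P w)"
    unfolding Q_def B_def by blast
qed

lemma opt_attained:
  assumes "feasible P w Q"
  obtains Og where "feasible P w Og" "card Og = opt P w"
  using LeastI_ex[of "\<lambda>k. \<exists>Q. feasible P w Q \<and> card Q = k"] assms unfolding opt_def by blast

lemma ratio_bound:
  fixes q k h :: nat
  assumes "q \<le> 3 * k" "q \<le> k + 5 * h"
  shows "real q \<le> min (1 + 5 * real h / real k) 3 * real k"
\<comment> \<open>For \<open>k = 0\<close> the quotient is 0 by convention; the right-hand side
  vanishes, and the first assumption gives \<open>q = 0\<close>.\<close>
proof (cases "k = 0")
  case False
  have "real q \<le> real k + 5 * real h" using assms(2) by linarith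
  also have "\<dots> = (1 + 5 * real h / real k) * real k" using False by (simp add: field_simps)
  finally have "real q \<le> (1 + 5 * real h / real k) * real k" .
  moreover have "real q \<le> 3 * real k" using assms(1) by linarith
  ultimately show ?thesis by (simp add: min_def)
qed (use assms in simp)

context stable_instance
begin

lemma valid_admissible: "valid_instance P w \<Longrightarrow> admissible w"
  unfolding valid_instance_def admissible_def by blast

text \<open>The strategy, by induction on the number of unqueried edges: repair while there are
  unexpected conflicts, then rebuild the matching, make a planned query if conflicts remain, and
  stop otherwise.\<close>

lemma midway_wins:
  assumes \<nu>: "\<And>w' Og. admissible w' \<Longrightarrow> feasible P w' Og \<Longrightarrow> \<nu> \<le> card Og + hop_distance P w'"
    and B: "\<And>w' q. q \<le> 3 * opt P w' \<Longrightarrow> q \<le> opt P w' + 5 * hop_distance P w' \<Longrightarrow> real q \<le> B P w'"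
    and "valid_instance P w" "midway \<nu> Q w S Q0 M V Cl (p ` X)" "robust Q w D R X p"
  shows "wins B P Q w"
  using assms(3-)
proof (induction "card (edges P - Q)" arbitrary: Q w S Q0 M V Cl p X D R rule: less_induct)
  case less
  have w: "admissible w" by (rule valid_admissible[OF less.prems(1)])
  have QE: "Q \<subseteq> edges P" using less.prems(2) unfolding midway_def by blast
  have finQ: "finite Q" using QE finite_edges finite_subset by blast
  have batch: "wins B P Q w"
    if A: "A \<noteq> {}" "A \<subseteq> edges P - Q" and next_state: "\<And>w'. admissible w' \<Longrightarrow> same_on Q w w' \<Longrightarrow>
      \<exists>S Q0 M V Cl p X D R. midway \<nu> (Q \<union> A) w' S Q0 M V Cl (p ` X) \<and> robust (Q \<union> A) w' D R X p" for A
  proof (rule wins_batch[OF finite_subset[OF A(2)] A(2) less.prems(1)])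
    show "finite (edges P - Q)" using finite_edges by simp
    fix w' assume w': "valid_instance P w'" "same_on Q w w'"
    obtain S Q0 M V Cl p X D R where "midway \<nu> (Q \<union> A) w' S Q0 M V Cl (p ` X)" "robust (Q \<union> A) w' D R X p"
      using next_state[OF valid_admissible[OF w'(1)] w'(2)] by blast
    moreover have "card (edges P - (Q \<union> A)) < card (edges P - Q)"
      using A finite_edges by (intro psubset_card_mono) auto
    ultimately show "wins B P (Q \<union> A) w'" using less.hyps w'(1) by blast
  qed
  obtain S' where S': "low_tree S' Q w" using low_tree_exists by blast
  show ?case
  proof (cases "confl S' Q w \<subseteq> confl S Q0 w \<inter> unknown Q \<times> unknown Q")
    case False
    obtain A where A: "A \<noteq> {}" "A \<subseteq> edges P - Q" "\<And>w'. admissible w' \<Longrightarrow> same_on Q w w' \<Longrightarrow>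
        midway \<nu> (Q \<union> A) w' S Q0 M V Cl (p ` X) \<and> robust (Q \<union> A) w' D (R \<union> A) X p"
      using repair[OF w less.prems(2,3) S' False] by blast
    show ?thesis by (rule batch[OF A(1,2)]) (intro exI, rule A(3))
  next
    case True
    obtain M' V' where set: "settled \<nu> Q w S' M' V' (p ` X)"
      using settle[OF w less.prems(2) S' True] by blast
    show ?thesis
    proof (cases "confl S' Q w = {}")
      case False
      obtain A where A: "A \<noteq> {}" "A \<subseteq> edges P - Q" "\<And>w'. admissible w' \<Longrightarrow> same_on Q w w' \<Longrightarrow>
          \<exists>Cl D' X' p'. midway \<nu> (Q \<union> A) w' S' Q M' V' Cl (p' ` X') \<and> robust (Q \<union> A) w' D' R X' p'"
        using planned_step[OF w set less.prems(3) False] by blast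
      show ?thesis
      proof (rule batch[OF A(1,2)])
        fix w' assume "admissible w'" "same_on Q w w'"
        from A(3)[OF this] obtain Cl' D' X' p' where
          "midway \<nu> (Q \<union> A) w' S' Q M' V' Cl' (p' ` X') \<and> robust (Q \<union> A) w' D' R X' p'"
          by (elim exE)
        then show "\<exists>S Q0 M V Cl p X D R. midway \<nu> (Q \<union> A) w' S Q0 M V Cl (p ` X) \<and> robust (Q \<union> A) w' D R X p"
          by (intro exI)
      qed
    next
      case True
      have f: "feasible P w Q"
        using no_conflict_feasible[OF w _ True QE] S' unfolding low_tree_def by blast
      show ?thesis
      proof (rule wins.stop[OF f])
        fix w' assume w': "valid_instance P w'" "same_on Q w w'"
        have a: "admissible w'" by (rule valid_admissible[OF w'(1)])
        have "feasible P w' Q" using f feasible_cong[of Q w w'] w'(2) unfolding same_on_def by blast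
        then obtain Og where Og: "feasible P w' Og" "card Og = opt P w'" by (rule opt_attained)
        \<comment> \<open>A repair with the empty set transfers the invariant to other weights with
          the same answers.\<close>
        have "robust Q w' (D \<union> {}) (R \<union> {}) X p"
          using robust_repair[OF less.prems(3) _ _ finQ w'(2), of "{}"] by simp
        then have "card Q \<le> 3 * opt P w'" using robust_final[OF _ finQ a Og(1)] Og(2) by simp
        moreover have "card Q \<le> \<nu> + 3 * hops w' Q"
          using set hops_cong[OF w'(2)] unfolding settled_def by simp
        then have "card Q \<le> opt P w' + 5 * hop_distance P w'"
          using \<nu>[OF a Og(1)] Og(2) hops_mono[OF QE, of w'] by linarith
        ultimately show "real (card Q) \<le> B P w'" by (rule B)
      qed
    qed
  qed
qed

text \<open>Before any query \<open>T\<close> is stable with \<open>crit\<close> as its set of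
  conflicts. The size of a maximum matching in \<open>crit\<close> serves as \<open>\<nu>\<close>,
  which \<open>crit_matching_bound\<close> compares with the optimum for all true weights.\<close>

lemma initial_wins:
  assumes B: "\<And>w' q. q \<le> 3 * opt P w' \<Longrightarrow> q \<le> opt P w' + 5 * hop_distance P w' \<Longrightarrow> real q \<le> B P w'"
    and w: "valid_instance P w"
  shows "wins B P {} w"
proof -
  note c = stable_confl[OF stable_initial[of w], unfolded confl_initial]
  obtain M V where "M \<subseteq> crit" "matching M" "covers V crit" "V \<subseteq> matched M" "\<forall>(e, f) \<in> M. e \<in> V \<longleftrightarrow> f \<notin> V"
    using matching_extends_to_cover[OF c(1,2), of "{}"] by (auto simp: matching_def)
  then have ec: "exact_cover (confl T {} w) M V" and M: "M \<subseteq> crit" "matching M"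
    unfolding exact_cover_def confl_initial by auto
  have "midway (card M) {} w T {} M V {} ((\<lambda>x. x) ` {})"
    using ec stable_initial[of w] unfolding midway_def by simp
  then show ?thesis
    by (intro midway_wins[where p = "\<lambda>x. x" and X = "{}" and D = "{}" and R = "{}" and \<nu> = "card M"])
       (use crit_matching_bound[OF _ _ M] B w robust_initial in auto)
qed

end

section \<open>From the instances of the theorem to the locale\<close>

lemma valid_graph: "valid_instance P w \<Longrightarrow> graph P"
  unfolding valid_instance_def by unfold_locales blast+

lemma stable_instance_of_valid:
  assumes valid: "valid_instance P w" and free: "prediction_mandatory_free P" and uniq: "unique_equal_limit_trees P"
  shows "\<exists>T. stable_instance P T"
proof -
  interpret graph P by (rule valid_graph[OF valid])
  obtain T where T: "is_mst P (low P) T" "\<And>S. is_mst P (low P) S \<Longrightarrow> S = T"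
    "is_mst P (upp P) T" "\<And>S. is_mst P (upp P) S \<Longrightarrow> S = T"
    using uniq unfolding unique_equal_limit_trees_def lower_limit_tree_iff upper_limit_tree_iff
    by (metis theI')
  have "stable_instance P T"
  proof
    show "base T" using T(1) is_mst_iff by blast
    show "low P e < low P f" "upp P e < upp P f" if "exch T e f" for e f
      using unique_mst_strict[OF T(1,2) that] unique_mst_strict[OF T(3,4) that] by auto
    show "admissible (pred P)" using valid unfolding valid_instance_def admissible_def by blast
  qed (rule free)
  then show ?thesis by blast
qed

theorem theorem5p3:
  "\<exists>alg :: ('v, 'e) algorithm.
     competitive alg
       (\<lambda>P w. min (1 + 5 * real (hop_distance P w) / real (opt P w)) 3)
       {(P, w). valid_instance P w \<and> prediction_mandatory_free P \<and> unique_equal_limit_trees P}"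
proof
  let ?\<rho> = "\<lambda>(P :: ('v, 'e) problem) w. min (1 + 5 * real (hop_distance P w) / real (opt P w)) 3"
  show "competitive (winning_query (\<lambda>P w. ?\<rho> P w * real (opt P w))) ?\<rho>
    {(P, w). valid_instance P w \<and> prediction_mandatory_free P \<and> unique_equal_limit_trees P}"
  proof (rule winning_query_competitive[where \<rho> = ?\<rho>])
    fix P :: "('v, 'e) problem" and w
    assume "(P, w) \<in> {(P, w). valid_instance P w \<and> prediction_mandatory_free P \<and> unique_equal_limit_trees P}"
    then have a: "valid_instance P w" "prediction_mandatory_free P" "unique_equal_limit_trees P" by auto
    obtain T where "stable_instance P T" using stable_instance_of_valid[OF a] by blast
    then interpret stable_instance P T .
    have "wins (\<lambda>P w. ?\<rho> P w * real (opt P w)) P {} w"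
      by (rule initial_wins[OF _ a(1)]) (rule ratio_bound)
    then show "valid_instance P w \<and> wins (\<lambda>P w. ?\<rho> P w * real (opt P w)) P {} w" using a(1) by blast
  qed
qed

end
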